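(* Let $X$ be a cocompact, locally finite CAT(0) cube complex with straight links. If $\partial X\neq B(X)$, then $X$ contains an unbounded convex subcomplex $Y$ such that the link, taken in $X$, of every vertex in $Y$ is a join.
   Context: Conventions. CAT(0) cube complexes are connected, with unit cubes; distances and geodesics are combinatorial (in the 1-skeleton). $X$ is locally finite if every vertex has finite valence, cocompact if its group of isometries (cubical automorphisms) acts cocompactly. A subcomplex $Y$ is convex if every geodesic between two vertices of $Y$ is contained in $Y$. For a hyperplane $\hat h$, the closures $h,h^*$ of the components of $X\setminus \hat h$ are its halfspaces. $X$ has straight links if for every vertex $v$ and every edge $e$ adjacent (incident) to $v$ there is an edge $f$ adjacent to $v$ such that the hyperplane dual to $e$ does not intersect the hyperplane dual to $f$. A graph $\Gamma$ is a join if its vertex set has a decomposition $V(\Gamma)=V_1\sqcup V_2$ with $V_1,V_2\ne\emptyset$ such that every vertex of $V_1$ is adjacent to every vertex of $V_2$; a flag simplicial complex (such as a vertex link) is a join if its 1-skeleton is a join. Boundaries. An ultrafilter on $X$ is a set $\alpha$ of halfspaces such that for every halfspace $h$ exactly one of $h,h^*$ is in $\alpha$, and if $h\in\alpha$, $h\subset k$ then $k\in\alpha$. $\mathcal{U}(X)$ is the set of ultrafilters, with topology having as basis $\mathcal{U}(X)$ together with the sets $\mathcal{U}_H=\{\alpha:H\subset\alpha\}$, $H$ a finite set of halfspaces. The Roller boundary $\partial X$ is the set of ultrafilters containing an infinite strictly descending chain of halfspaces (i.e. failing the descending chain condition). An ultrafilter $\alpha$ is non-terminating if for every $h\in\alpha$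 there is $k\in\alpha$ with $k\subsetneq h$. $B(X)$ is the closure in $\mathcal{U}(X)$ of the set of non-terminating ultrafilters in $\partial X$. *)

theory Defs
  imports "HOL-Analysis.Analysis"
begin

text \<open>
  CAT(0) cube complexes are treated combinatorially.  Every cube of a CAT(0) cube complex is
  embedded and two cubes meet in a common face or not at all, so the complex is recorded by the
  family of the vertex sets of its cubes; a subcomplex is a subfamily closed under faces.
\<close>

section \<open>Cube complexes\<close>

text \<open>
  The map \<open>\<phi>\<close> identifies the vertex set of the standard cube \<open>[0,1]\<^sup>n\<close>, written as the power set of
  \<open>{..<n}\<close>, with \<open>C\<close>.  The vertex sets of the faces of \<open>[0,1]\<^sup>n\<close> are the order intervals of the
  power set.
\<close>

definition cube_chart :: "'v set set \<Rightarrow> 'v set \<Rightarrow> nat \<Rightarrow> (nat set \<Rightarrow> 'v) \<Rightarrow> bool" where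
  "cube_chart X C n \<phi> \<longleftrightarrow>
     bij_betw \<phi> (Pow {..<n}) C \<and>
     {D \<in> X. D \<subseteq> C} = {\<phi> ` {S. A \<subseteq> S \<and> S \<subseteq> B} |A B. A \<subseteq> B \<and> B \<subseteq> {..<n}}"

definition cube_complex :: "'v set set \<Rightarrow> bool" where
  "cube_complex X \<longleftrightarrow>
     (\<forall>C\<in>X. \<exists>n \<phi>. cube_chart X C n \<phi>) \<and>
     (\<forall>C\<in>X. \<forall>D\<in>X. C \<inter> D \<noteq> {} \<longrightarrow> C \<inter> D \<in> X)"

definition verts :: "'v set set \<Rightarrow> 'v set" where
  "verts X = \<Union>X"

definition edges :: "'v set set \<Rightarrow> 'v set set" where
  "edges X = {C \<in> X. card C = 2}"

definition squares :: "'v set set \<Rightarrow> 'v set set" where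
  "squares X = {C \<in> X. card C = 4}"

definition subcomplex :: "'v set set \<Rightarrow> 'v set set \<Rightarrow> bool" where
  "subcomplex Y X \<longleftrightarrow> Y \<subseteq> X \<and> (\<forall>C\<in>Y. \<forall>D\<in>X. D \<subseteq> C \<longrightarrow> D \<in> Y)"


section \<open>Edge paths, distance and simple connectivity\<close>

definition edge_path :: "'v set set \<Rightarrow> 'v list \<Rightarrow> bool" where
  "edge_path X p \<longleftrightarrow>
     p \<noteq> [] \<and> set p \<subseteq> verts X \<and> successively (\<lambda>u v. {u, v} \<in> edges X) p"

definition edge_connected :: "'v set set \<Rightarrow> bool" where
  "edge_connected X \<longleftrightarrow>
     (\<forall>u\<in>verts X. \<forall>v\<in>verts X. \<exists>p. edge_path X p \<and> hd p = u \<and> last p = v)"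

definition comb_dist :: "'v set set \<Rightarrow> 'v \<Rightarrow> 'v \<Rightarrow> nat" where
  "comb_dist X u v =
     (LEAST n. \<exists>p. edge_path X p \<and> hd p = u \<and> last p = v \<and> length p = Suc n)"

definition comb_geodesic :: "'v set set \<Rightarrow> 'v list \<Rightarrow> bool" where
  "comb_geodesic X p \<longleftrightarrow> edge_path X p \<and> length p = Suc (comb_dist X (hd p) (last p))"

text \<open>
  Homotopy rel endpoints of edge paths is generated by deleting backtracks and by pushing a path
  across a square; this computes the fundamental group of the (2-skeleton of the) complex.
\<close>

inductive elem_move :: "'v set set \<Rightarrow> 'v list \<Rightarrow> 'v list \<Rightarrow> bool" for X where
  backtrack:
    "\<lbrakk>edge_path X (p @ [u, v, u] @ q)\<rbrakk> \<Longrightarrow> elem_move X (p @ [u, v, u] @ q) (p @ [u] @ q)"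
| square:
    "\<lbrakk>edge_path X (p @ [u, v, w] @ q); edge_path X (p @ [u, v', w] @ q);
      {u, v, w, v'} \<in> squares X\<rbrakk>
     \<Longrightarrow> elem_move X (p @ [u, v, w] @ q) (p @ [u, v', w] @ q)"

definition path_homotopic :: "'v set set \<Rightarrow> 'v list \<Rightarrow> 'v list \<Rightarrow> bool" where
  "path_homotopic X = equivclp (elem_move X)"

definition edge_simply_connected :: "'v set set \<Rightarrow> bool" where
  "edge_simply_connected X \<longleftrightarrow>
     edge_connected X \<and>
     (\<forall>p. edge_path X p \<and> hd p = last p \<longrightarrow> path_homotopic X p [hd p])"


section \<open>Links and the CAT(0) condition\<close>

text \<open>
  Abstract simplicial complexes are families of simplices, with the empty simplex included and
  vertex set the union of the family.  The vertices of the link of \<open>v\<close> are the edges at \<open>v\<close>; each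
  cube at \<open>v\<close> spans a simplex (the cube \<open>{v}\<close> the empty one).
\<close>

definition vertex_link :: "'v set set \<Rightarrow> 'v \<Rightarrow> 'v set set set" where
  "vertex_link X v = (\<lambda>C. {e \<in> edges X. v \<in> e \<and> e \<subseteq> C}) ` {C \<in> X. v \<in> C}"

definition flag_complex :: "'a set set \<Rightarrow> bool" where
  "flag_complex K \<longleftrightarrow>
     (\<forall>S. finite S \<and> S \<subseteq> \<Union>K \<and> (\<forall>x\<in>S. \<forall>y\<in>S. {x, y} \<in> K) \<longrightarrow> S \<in> K)"

definition graph_join :: "'a set \<Rightarrow> ('a \<Rightarrow> 'a \<Rightarrow> bool) \<Rightarrow> bool" where
  "graph_join V adj \<longleftrightarrow>
     (\<exists>V1 V2. V1 \<noteq> {} \<and> V2 \<noteq> {} \<and> V1 \<inter> V2 = {} \<and> V1 \<union> V2 = V \<and> (\<forall>x\<in>V1. \<forall>y\<in>V2. adj x y))"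

definition complex_join :: "'a set set \<Rightarrow> bool" where
  "complex_join K \<longleftrightarrow> graph_join (\<Union>K) (\<lambda>x y. x \<noteq> y \<and> {x, y} \<in> K)"

text \<open>
  Gromov's criterion is taken as the definition: a CAT(0) cube complex is a nonempty simply
  connected cube complex all of whose vertex links are flag.
\<close>

definition cat0_cube_complex :: "'v set set \<Rightarrow> bool" where
  "cat0_cube_complex X \<longleftrightarrow>
     X \<noteq> {} \<and> cube_complex X \<and> edge_simply_connected X \<and>
     (\<forall>v\<in>verts X. flag_complex (vertex_link X v))"


section \<open>Finiteness conditions\<close>

definition locally_finite_complex :: "'v set set \<Rightarrow> bool" where
  "locally_finite_complex X \<longleftrightarrow> (\<forall>v\<in>verts X. finite {e \<in> edges X. v \<in> e})"

definition cubical_aut :: "'v set set \<Rightarrow> ('v \<Rightarrow> 'v) \<Rightarrow> bool" where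
  "cubical_aut X g \<longleftrightarrow> bij_betw g (verts X) (verts X) \<and> (\<lambda>C. g ` C) ` X = X"

text \<open>
  A compact subset lies in a finite union of cubes, so cocompactness means that the translates of
  finitely many cubes cover the complex.
\<close>

definition cocompact_complex :: "'v set set \<Rightarrow> bool" where
  "cocompact_complex X \<longleftrightarrow>
     (\<exists>K. finite K \<and> K \<subseteq> X \<and> (\<forall>C\<in>X. \<exists>D\<in>K. \<exists>g. cubical_aut X g \<and> C = g ` D))"


section \<open>Hyperplanes and halfspaces\<close>

text \<open>A hyperplane is recorded by its set of dual edges, a parallelism class of edges.\<close>

definition opposite_edges :: "'v set set \<Rightarrow> 'v set \<Rightarrow> 'v set \<Rightarrow> bool" where
  "opposite_edges X e f \<longleftrightarrow>
     e \<in> edges X \<and> f \<in> edges X \<and> e \<inter> f = {} \<and> (\<exists>C\<in>squares X. e \<subseteq> C \<and> f \<subseteq> C)"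

definition dual_hyperplane :: "'v set set \<Rightarrow> 'v set \<Rightarrow> 'v set set" where
  "dual_hyperplane X e = {f \<in> edges X. (opposite_edges X)\<^sup>*\<^sup>* e f}"

definition hyperplanes :: "'v set set \<Rightarrow> 'v set set set" where
  "hyperplanes X = dual_hyperplane X ` edges X"

text \<open>
  Geometrically a hyperplane is a union of midcubes, and any two midcubes of one cube share its
  centre.  So two hyperplanes intersect iff some cube contains edges dual to both; in particular
  every hyperplane intersects itself.
\<close>

definition hyperplanes_meet :: "'v set set \<Rightarrow> 'v set set \<Rightarrow> 'v set set \<Rightarrow> bool" where
  "hyperplanes_meet X H H' \<longleftrightarrow> (\<exists>C\<in>X. \<exists>e\<in>H. \<exists>f\<in>H'. e \<subseteq> C \<and> f \<subseteq> C)"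

definition straight_links :: "'v set set \<Rightarrow> bool" where
  "straight_links X \<longleftrightarrow>
     (\<forall>v\<in>verts X. \<forall>e\<in>edges X. v \<in> e \<longrightarrow>
        (\<exists>f\<in>edges X. v \<in> f \<and>
           \<not> hyperplanes_meet X (dual_hyperplane X e) (dual_hyperplane X f)))"

text \<open>
  A halfspace is recorded by its vertex set: a component of what remains of the 1-skeleton after
  the edges dual to a hyperplane are removed.  In a CAT(0) cube complex there are exactly two such
  components, so the complementary halfspace is the complementary vertex set.
\<close>

definition cut_component :: "'v set set \<Rightarrow> 'v set set \<Rightarrow> 'v \<Rightarrow> 'v set" where
  "cut_component X H v = {w. (\<lambda>a b. {a, b} \<in> edges X - H)\<^sup>*\<^sup>* v w}"

definition halfspaces :: "'v set set \<Rightarrow> 'v set set" where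
  "halfspaces X = {cut_component X H v |H v. H \<in> hyperplanes X \<and> v \<in> verts X}"

definition opp_halfspace :: "'v set set \<Rightarrow> 'v set \<Rightarrow> 'v set" where
  "opp_halfspace X h = verts X - h"


section \<open>Ultrafilters and boundaries\<close>

definition ultrafilters :: "'v set set \<Rightarrow> 'v set set set" where
  "ultrafilters X =
     {\<alpha>. \<alpha> \<subseteq> halfspaces X \<and>
         (\<forall>h\<in>halfspaces X. (h \<in> \<alpha>) \<noteq> (opp_halfspace X h \<in> \<alpha>)) \<and>
         (\<forall>h\<in>\<alpha>. \<forall>k\<in>halfspaces X. h \<subseteq> k \<longrightarrow> k \<in> \<alpha>)}"

text \<open>
  The sets below already form a basis: they are closed under binary intersection, and \<open>H = {}\<close>
  gives the whole space.
\<close>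

definition ultrafilter_topology :: "'v set set \<Rightarrow> 'v set set topology" where
  "ultrafilter_topology X =
     topology_generated_by
       {{\<alpha> \<in> ultrafilters X. H \<subseteq> \<alpha>} |H. finite H \<and> H \<subseteq> halfspaces X}"

definition roller_boundary :: "'v set set \<Rightarrow> 'v set set set" where
  "roller_boundary X =
     {\<alpha> \<in> ultrafilters X. \<exists>c :: nat \<Rightarrow> 'v set. \<forall>n. c n \<in> \<alpha> \<and> c (Suc n) \<subset> c n}"

definition non_terminating :: "'v set set \<Rightarrow> bool" where
  "non_terminating \<alpha> \<longleftrightarrow> (\<forall>h\<in>\<alpha>. \<exists>k\<in>\<alpha>. k \<subset> h)"

definition nt_boundary :: "'v set set \<Rightarrow> 'v set set set" where
  "nt_boundary X =
     ultrafilter_topology X closure_of {\<alpha> \<in> roller_boundary X. non_terminating \<alpha>}"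


section \<open>Convex and unbounded subcomplexes\<close>

definition convex_subcomplex :: "'v set set \<Rightarrow> 'v set set \<Rightarrow> bool" where
  "convex_subcomplex Y X \<longleftrightarrow>
     subcomplex Y X \<and>
     (\<forall>p. comb_geodesic X p \<and> hd p \<in> verts Y \<and> last p \<in> verts Y \<longrightarrow> edge_path Y p)"

definition unbounded_subcomplex :: "'v set set \<Rightarrow> 'v set set \<Rightarrow> bool" where
  "unbounded_subcomplex Y X \<longleftrightarrow>
     subcomplex Y X \<and> (\<forall>n. \<exists>u\<in>verts Y. \<exists>v\<in>verts Y. n < comb_dist X u v)"

end

theory Submission
  imports Defs
begin

text \<open>
  Why the theorem holds. Let \<open>\<alpha>\<close> be a boundary point outside the closure of the non-terminating
  ultrafilters: some finite \<open>H \<subseteq> \<alpha>\<close> lies in no non-terminating ultrafilter. Straight links say that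
  every halfspace bounded by an edge at a vertex \<open>v\<close> can be dug into by crossing another edge at \<open>v\<close>.
  Digging again and again, always away from a base point \<open>p\<close>, produces a non-terminating ultrafilter
  that contains every halfspace entered on the way; so a family of halfspaces lies in a
  non-terminating ultrafilter as soon as both the halfspaces and their complements have a common
  vertex (\<open>nt_exists\<close>). The family \<open>H\<close> must therefore fail this, and the failure is made canonical as
  follows.

  An \<^emph>\<open>obstruction\<close> is a pair of finite families \<open>K \<noteq> {}\<close> and \<open>I\<close> such that the members of \<open>K\<close> are
  pairwise transverse, every member of \<open>K\<close> is transverse to every member of \<open>I\<close>, the members of \<open>I\<close>
  meet pairwise, and no non-terminating ultrafilter contains \<open>K \<union> I\<close>. A deep member of a descending
  chain in \<open>\<alpha>\<close>, together with those members of \<open>H\<close> whose hyperplanes are crossed by the whole chain,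
  is one (\<open>obstruction_exists\<close>). The hyperplanes of \<open>K\<close> are all adjacent to one vertex, so \<open>card K\<close> is
  at most the valence bound; hence there is an obstruction with \<open>I\<close> as small as possible and, given
  that, \<open>K\<close> as large as possible. Let \<open>Y\<close> be the intersection of \<open>K \<union> I\<close>. At a vertex \<open>v\<close> of \<open>Y\<close>
  call an edge outgoing if its hyperplane is transverse to all of \<open>K\<close>.
  Minimality of \<open>I\<close> forces the hyperplane of every non-outgoing edge to be transverse to all of \<open>I\<close>.
  Minimality of \<open>I\<close> with maximality of \<open>K\<close> forces the far side of every outgoing edge to contain the
  complement of some \<open>h \<in> I\<close>. So the far sides of an outgoing and a non-outgoing edge meet, hence the
  two edges span a square, and the link of \<open>v\<close> is the join of the two kinds of edges. Both kinds
  occur (look at the edge through which \<open>v\<close> leaves towards the complement of a member of \<open>K\<close>, or of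
  \<open>I\<close>), and digging into a member of \<open>K\<close> shows that \<open>Y\<close> is unbounded (\<open>join_region\<close>).

  The argument needs the classical geometry of hyperplanes, which has to be derived from simple
  connectivity and flag links. The bridge is a rewriting argument on edge paths. Call a path reduced
  if no sequence of square moves produces a backtrack. The lemma \<open>last_edges\<close>, where the 3-cubes
  given by flagness enter, describes how two paths that differ by square moves can end. It makes
  reduction of paths well defined and invariant under homotopy. By simple connectivity, reduced
  paths with the same endpoints differ by square moves, so they are exactly the geodesics. This gives
  the quadrangle condition (\<open>quadrangle_square\<close>), from which halfspaces, their convexity, gates and
  the Helly property follow by metric arguments in the 1-skeleton.
\<close>

section \<open>Cubes, squares and links\<close>

locale cubes =
  fixes X :: "'v set set"
  assumes cx: "cube_complex X"
begin

abbreviation adj :: "'v \<Rightarrow> 'v \<Rightarrow> bool" where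
  "adj u v \<equiv> {u, v} \<in> edges X"

text \<open>
  The vertices are listed in cyclic order, so that \<open>b\<close> and \<open>e\<close> are the two corners next to \<open>a\<close>.
\<close>

definition sq :: "'v \<Rightarrow> 'v \<Rightarrow> 'v \<Rightarrow> 'v \<Rightarrow> bool" where
  "sq a b c e \<longleftrightarrow> {a, b, c, e} \<in> squares X \<and> adj a b \<and> adj b c \<and> adj c e \<and> adj e a"

lemma adj_sym: "adj u v \<Longrightarrow> adj v u"
  by (simp add: insert_commute)

lemma adj_neq: "adj u v \<Longrightarrow> u \<noteq> v"
  by (auto simp: edges_def)

lemma adj_verts: "adj u v \<Longrightarrow> u \<in> verts X" "adj u v \<Longrightarrow> v \<in> verts X"
  by (auto simp: edges_def verts_def)

text \<open>
  Taking the symmetric difference with a fixed set is a symmetry of the standard cube that maps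
  order intervals to order intervals, so any chosen vertex can be moved to the corner \<open>{}\<close>.
\<close>

lemma cube_chart_at:
  assumes "C \<in> X" and "v \<in> C"
  obtains n \<phi> where "cube_chart X C n \<phi>" and "\<phi> {} = v"
proof -
  obtain n \<psi> where \<psi>: "cube_chart X C n \<psi>"
    using cx assms by (auto simp: cube_complex_def)
  then have bij: "bij_betw \<psi> (Pow {..<n}) C"
    and faces: "{D \<in> X. D \<subseteq> C} = {\<psi> ` {S. A \<subseteq> S \<and> S \<subseteq> B} |A B. A \<subseteq> B \<and> B \<subseteq> {..<n}}"
    by (auto simp: cube_chart_def)
  obtain R where R: "R \<subseteq> {..<n}" "\<psi> R = v"
    using bij assms by (auto simp: bij_betw_def)
  \<comment> \<open>the symmetric difference with \<open>R\<close>, an involution that exchanges \<open>{}\<close> and \<open>R\<close>\<close>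
  define t where "t S = (S - R) \<union> (R - S)" for S
  have t_t: "t (t S) = S" for S by (auto simp: t_def)
  have t_iv: "t ` {S. A \<subseteq> S \<and> S \<subseteq> B} = {S. (A - R) \<union> (R - B) \<subseteq> S \<and> S \<subseteq> (A - R) \<union> (R - B) \<union> (B - A)}"
    (is "_ = ?J") if "A \<subseteq> B" for A B
  proof (intro subset_antisym subsetI)
    fix S assume "S \<in> t ` {S. A \<subseteq> S \<and> S \<subseteq> B}"
    then show "S \<in> ?J" using that by (auto simp: t_def)
  next
    fix S assume S: "S \<in> ?J"
    have "A \<subseteq> t S \<and> t S \<subseteq> B" using S that by (auto simp: t_def)
    then have "t (t S) \<in> t ` {S. A \<subseteq> S \<and> S \<subseteq> B}" by blast
    then show "S \<in> t ` {S. A \<subseteq> S \<and> S \<subseteq> B}" by (simp add: t_t)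
  qed
  let ?F = "\<lambda>f. {f ` {S. A \<subseteq> S \<and> S \<subseteq> B} |A B. A \<subseteq> B \<and> B \<subseteq> {..<n}}"
  have sub: "?F (f \<circ> t) \<subseteq> ?F f" for f :: "nat set \<Rightarrow> 'v"
  proof
    fix D assume "D \<in> ?F (f \<circ> t)"
    then obtain A B where AB: "A \<subseteq> B" "B \<subseteq> {..<n}" and D: "D = f ` (t ` {S. A \<subseteq> S \<and> S \<subseteq> B})"
      by (auto simp: image_comp)
    show "D \<in> ?F f"
      unfolding D t_iv[OF AB(1)] mem_Collect_eq
      by (intro exI conjI, rule refl) (use AB R in auto)
  qed
  have "(\<psi> \<circ> t) \<circ> t = \<psi>" by (simp add: fun_eq_iff t_t)
  then have "?F \<psi> \<subseteq> ?F (\<psi> \<circ> t)" using sub[of "\<psi> \<circ> t"] by simp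
  with sub[of \<psi>] have "?F (\<psi> \<circ> t) = ?F \<psi>" by (rule subset_antisym)
  moreover have "bij_betw t (Pow {..<n}) (Pow {..<n})"
    by (rule bij_betw_byWitness[where f' = t]) (use R in \<open>auto simp: t_t\<close>, auto simp: t_def)
  then have "bij_betw (\<psi> \<circ> t) (Pow {..<n}) C" using bij by (rule bij_betw_trans)
  ultimately have "cube_chart X C n (\<psi> \<circ> t)" using faces by (simp add: cube_chart_def)
  moreover have "(\<psi> \<circ> t) {} = v" using R by (simp add: t_def)
  ultimately show thesis using that by blast
qed

lemma face_in:
  assumes "cube_chart X C n \<phi>" "A \<subseteq> B" "B \<subseteq> {..<n}"
  shows "\<phi> ` {S. A \<subseteq> S \<and> S \<subseteq> B} \<in> X"
proof -
  have "\<phi> ` {S. A \<subseteq> S \<and> S \<subseteq> B} \<in> {\<phi> ` {S. A \<subseteq> S \<and> S \<subseteq> B} |A B. A \<subseteq> B \<and> B \<subseteq> {..<n}}"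
    using assms(2,3) by (intro CollectI exI conjI) (rule refl)
  also have "\<dots> = {D \<in> X. D \<subseteq> C}" using assms(1) by (simp add: cube_chart_def)
  finally show ?thesis by simp
qed

lemma chart_inj:
  assumes "cube_chart X C n \<phi>" "S \<subseteq> {..<n}" "T \<subseteq> {..<n}"
  shows "\<phi> S = \<phi> T \<longleftrightarrow> S = T"
  using assms by (auto simp: cube_chart_def bij_betw_def inj_on_def)

lemma card_cube:
  assumes "C \<in> X" obtains n where "card C = 2 ^ n" "finite C"
proof -
  obtain n \<phi> where "cube_chart X C n \<phi>"
    using cx assms by (auto simp: cube_complex_def)
  then have b: "bij_betw \<phi> (Pow {..<n}) C" by (simp add: cube_chart_def)
  have "card C = 2 ^ n" using bij_betw_same_card[OF b] by (simp add: card_Pow)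
  moreover have "finite C" using bij_betw_finite[OF b] by simp
  ultimately show thesis using that by blast
qed

lemma cube_Int: "C \<in> X \<Longrightarrow> D \<in> X \<Longrightarrow> C \<inter> D \<noteq> {} \<Longrightarrow> C \<inter> D \<in> X"
  using cx by (simp add: cube_complex_def)

lemma vertex_cube: "v \<in> verts X \<Longrightarrow> {v} \<in> X"
proof -
  assume "v \<in> verts X"
  then obtain C where C: "C \<in> X" "v \<in> C" by (auto simp: verts_def)
  obtain n \<phi> where ch: "cube_chart X C n \<phi>" "\<phi> {} = v" by (rule cube_chart_at[OF C])
  have "\<phi> ` {S. {} \<subseteq> S \<and> S \<subseteq> {}} \<in> X" by (rule face_in[OF ch(1)]) auto
  moreover have "{S. {} \<subseteq> S \<and> S \<subseteq> {}} = {{}::nat set}" by auto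
  ultimately show ?thesis using ch(2) by simp
qed

lemma interval_insert: "{S. A \<subseteq> S \<and> S \<subseteq> insert i A} = {A, insert i A}"
proof -
  have "S = A \<or> S = insert i A" if "A \<subseteq> S" "S \<subseteq> insert i A" for S
    using that by (cases "i \<in> S") blast+
  then show ?thesis by blast
qed

lemma interval_insert2: "{S. A \<subseteq> S \<and> S \<subseteq> insert i (insert j A)} = {A, insert i A, insert i (insert j A), insert j A}"
proof -
  have "S \<in> {A, insert i A, insert i (insert j A), insert j A}"
    if "A \<subseteq> S" "S \<subseteq> insert i (insert j A)" for S
  proof (cases "i \<in> S"; cases "j \<in> S")
    assume "i \<in> S" "j \<in> S" then have "S = insert i (insert j A)" using that by blast
    then show ?thesis by simp
  next
    assume "i \<in> S" "j \<notin> S" then have "S = insert i A" using that by blast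
    then show ?thesis by simp
  next
    assume "i \<notin> S" "j \<in> S" then have "S = insert j A" using that by blast
    then show ?thesis by simp
  next
    assume "i \<notin> S" "j \<notin> S" then have "S = A" using that by blast
    then show ?thesis by simp
  qed
  then show ?thesis by blast
qed

lemma chart_edge:
  assumes ch: "cube_chart X C n \<phi>" and "insert i A \<subseteq> {..<n}" "i \<notin> A"
  shows "adj (\<phi> A) (\<phi> (insert i A))"
proof -
  have "\<phi> ` {S. A \<subseteq> S \<and> S \<subseteq> insert i A} \<in> X" by (rule face_in[OF ch]) (use assms in auto)
  moreover have "\<phi> A \<noteq> \<phi> (insert i A)" using assms by (subst chart_inj[OF ch]) auto
  ultimately show ?thesis using assms by (simp add: interval_insert edges_def)
qed

lemma chart_sq:
  assumes ch: "cube_chart X C n \<phi>" and "insert i (insert j A) \<subseteq> {..<n}" "i \<notin> A" "j \<notin> A" "i \<noteq> j"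
  shows "sq (\<phi> A) (\<phi> (insert i A)) (\<phi> (insert i (insert j A))) (\<phi> (insert j A))"
proof -
  have *: "\<phi> ` {S. A \<subseteq> S \<and> S \<subseteq> insert i (insert j A)} \<in> X" by (rule face_in[OF ch]) (use assms in auto)
  have "{\<phi> A, \<phi> (insert i A), \<phi> (insert i (insert j A)), \<phi> (insert j A)} \<in> X"
    using * assms by (simp add: interval_insert2)
  moreover have "inj_on \<phi> {A, insert i A, insert i (insert j A), insert j A}"
    by (rule inj_on_subset[of _ "Pow {..<n}"])
      (use ch assms in \<open>auto simp: cube_chart_def bij_betw_def\<close>)
  then have "card (\<phi> ` {A, insert i A, insert i (insert j A), insert j A}) = card {A, insert i A, insert i (insert j A), insert j A}"
    by (rule card_image)
  moreover have "card {A, insert i A, insert i (insert j A), insert j A} = 4"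
    using assms by (auto simp: card_insert_if)
  moreover have "adj (\<phi> A) (\<phi> (insert i A))" "adj (\<phi> A) (\<phi> (insert j A))"
    "adj (\<phi> (insert i A)) (\<phi> (insert j (insert i A)))" "adj (\<phi> (insert j A)) (\<phi> (insert i (insert j A)))"
    by (rule chart_edge[OF ch]; use assms in auto)+
  ultimately show ?thesis by (simp add: sq_def squares_def insert_commute)
qed

lemma chart_edges_at:
  assumes ch: "cube_chart X C n \<phi>" "\<phi> {} = v"
  shows "{e \<in> edges X. v \<in> e \<and> e \<subseteq> C} = (\<lambda>i. {v, \<phi> {i}}) ` {..<n}"
proof (intro subset_antisym subsetI)
  fix e assume "e \<in> {e \<in> edges X. v \<in> e \<and> e \<subseteq> C}"
  then have e: "e \<in> X" "card e = 2" "v \<in> e" "e \<subseteq> C" by (auto simp: edges_def)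
  then have "e \<in> {D \<in> X. D \<subseteq> C}" by simp
  then obtain A B where AB: "A \<subseteq> B" "B \<subseteq> {..<n}" and eq: "e = \<phi> ` {S. A \<subseteq> S \<and> S \<subseteq> B}"
    using ch unfolding cube_chart_def by auto
  obtain S where S: "v = \<phi> S" "A \<subseteq> S" "S \<subseteq> B" using e(3) eq by auto
  then have "S = {}" using ch chart_inj[OF ch(1), of S "{}"] AB by auto
  then have "A = {}" using S by auto
  then have eq': "e = \<phi> ` Pow B" using eq by (simp add: Pow_def)
  have "inj_on \<phi> (Pow B)"
    by (rule inj_on_subset[of _ "Pow {..<n}"]) (use ch AB(2) in \<open>auto simp: cube_chart_def bij_betw_def\<close>)
  then have "card e = 2 ^ card B" using eq' AB(2) by (simp add: card_image card_Pow finite_subset)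
  then have "card B = 1" using e(2) power_inject_exp[of "2::nat" "card B" 1] by simp
  then obtain i where "B = {i}" by (auto simp: card_1_singleton_iff)
  moreover have "Pow {i} = {{}, {i}}" by auto
  ultimately show "e \<in> (\<lambda>i. {v, \<phi> {i}}) ` {..<n}" using eq' AB ch by auto
next
  fix e assume "e \<in> (\<lambda>i. {v, \<phi> {i}}) ` {..<n}"
  then obtain i where i: "i < n" "e = {v, \<phi> {i}}" by auto
  then have "adj (\<phi> {}) (\<phi> {i})" by (intro chart_edge[OF ch(1)]) auto
  moreover have "\<phi> {} \<in> C" "\<phi> {i} \<in> C" using i ch by (auto simp: cube_chart_def bij_betw_def)
  ultimately show "e \<in> {e \<in> edges X. v \<in> e \<and> e \<subseteq> C}" using i ch by auto
qed

lemma square_chart_at: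
  assumes "C \<in> squares X" "v \<in> C"
  obtains a b c where "sq v a c b" "C = {v, a, c, b}" "{e \<in> edges X. v \<in> e \<and> e \<subseteq> C} = {{v, a}, {v, b}}"
proof -
  have C: "C \<in> X" "card C = 4" using assms by (auto simp: squares_def)
  obtain n \<phi> where ch: "cube_chart X C n \<phi>" "\<phi> {} = v" by (rule cube_chart_at[OF C(1) assms(2)])
  have bij: "bij_betw \<phi> (Pow {..<n}) C" using ch by (simp add: cube_chart_def)
  have "card C = 2 ^ n" using bij_betw_same_card[OF bij] by (simp add: card_Pow)
  then have n: "n = 2" using C(2) power_inject_exp[of "2::nat" n 2] by simp
  have *: "insert 0 (insert 1 {}) = {..<n}" unfolding n by auto
  have s: "sq (\<phi> {}) (\<phi> {0}) (\<phi> {0, 1}) (\<phi> {1})" by (rule chart_sq[OF ch(1)]) (use n in auto)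
  have "Pow {..<n} = {{}, {0}, {0,1}, {1}}"
    using interval_insert2[of "{}" 0 1] unfolding *[symmetric] Pow_def by (simp del: One_nat_def)
  then have "C = {\<phi> {}, \<phi> {0}, \<phi> {0, 1}, \<phi> {1}}" using bij by (auto simp: bij_betw_def)
  moreover have "{e \<in> edges X. v \<in> e \<and> e \<subseteq> C} = {{v, \<phi> {0}}, {v, \<phi> {1}}}"
    unfolding chart_edges_at[OF ch] *[symmetric] by simp
  ultimately show thesis using that s ch by simp
qed

lemma sq_rot: "sq a b c e \<Longrightarrow> sq b c e a"
  by (auto simp: sq_def insert_commute)

lemma sq_flip: "sq a b c e \<Longrightarrow> sq a e c b"
  by (auto simp: sq_def insert_commute)

lemma sq_distinct: "sq a b c e \<Longrightarrow> distinct [a, b, c, e]"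
proof -
  assume "sq a b c e"
  then have "card (set [a,b,c,e]) = 4" by (simp add: sq_def squares_def)
  then show ?thesis by (intro card_distinct) simp
qed

text \<open>
  Two different such squares would meet in exactly three vertices, but the intersection is a cube
  and therefore has a power of two many.
\<close>

lemma sq_unique: assumes "sq a b c e" "sq a b c e'" shows "e = e'"
proof (rule ccontr)
  assume ne: "e \<noteq> e'"
  have d: "distinct [a,b,c,e]" "distinct [a,b,c,e']" using assms sq_distinct by blast+
  have in_X: "{a,b,c,e} \<in> X" "{a,b,c,e'} \<in> X" using assms by (auto simp: sq_def squares_def)
  have eq: "{a,b,c,e} \<inter> {a,b,c,e'} = {a,b,c}" using ne d by auto
  have "{a,b,c,e} \<inter> {a,b,c,e'} \<noteq> {}" unfolding eq by simp
  then have "{a,b,c,e} \<inter> {a,b,c,e'} \<in> X" by (rule cube_Int[OF in_X])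
  then obtain n where "card {a,b,c} = 2 ^ n" unfolding eq by (rule card_cube)
  moreover have "card {a,b,c} = 3" using d by auto
  ultimately have "2 ^ n = (3::nat)" by simp
  moreover have "odd (3::nat)" by simp
  ultimately have "n = 0" by (metis even_power even_numeral gr0I)
  then show False using \<open>2 ^ n = 3\<close> by simp
qed

lemma sq_unique_opp: assumes "sq a b c e" "sq a b c' e" shows "c = c'"
  using assms[THEN sq_rot, THEN sq_rot, THEN sq_rot] by (rule sq_unique)

lemma link_memI:
  "C \<in> X \<Longrightarrow> v \<in> C \<Longrightarrow> {e \<in> edges X. v \<in> e \<and> e \<subseteq> C} = S \<Longrightarrow> S \<in> vertex_link X v"
  unfolding vertex_link_def by (rule image_eqI[where x = C]) auto

lemma sq_link:
  assumes "sq v a c b" shows "{{v, a}, {v, b}} \<in> vertex_link X v"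
proof -
  let ?C = "{v, a, c, b}"
  have C: "?C \<in> squares X" using assms by (simp add: sq_def)
  obtain a' b' c' where *: "sq v a' c' b'" "?C = {v, a', c', b'}"
     "{e \<in> edges X. v \<in> e \<and> e \<subseteq> ?C} = {{v, a'}, {v, b'}}"
    by (rule square_chart_at[OF C, of v]) auto
  have vab: "adj v a" "adj v b" using assms adj_sym by (auto simp: sq_def)
  have "{{v, a}, {v, b}} \<subseteq> {e \<in> edges X. v \<in> e \<and> e \<subseteq> ?C}" using vab by simp
  then have sub: "{{v, a}, {v, b}} \<subseteq> {{v, a'}, {v, b'}}" unfolding *(3) .
  have ne: "{v, a} \<noteq> {v, b}" using sq_distinct[OF assms] by (auto simp: doubleton_eq_iff)
  have two: "{p, q} \<subseteq> {r, s} \<Longrightarrow> p \<noteq> q \<Longrightarrow> {r, s} = {p, q}" for p q r s :: "'v set" by blast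
  have "{e \<in> edges X. v \<in> e \<and> e \<subseteq> ?C} = {{v, a}, {v, b}}"
    unfolding *(3) by (rule two[OF sub ne])
  moreover have "?C \<in> {C \<in> X. v \<in> C}" using C by (simp add: squares_def)
  ultimately show ?thesis by (intro link_memI) auto
qed

lemma opposite_sq:
  assumes "opposite_edges X {u, v} f"
  obtains x y where "f = {x, y}" "sq u v y x"
proof -
  obtain C where C: "C \<in> squares X" "{u, v} \<subseteq> C" "f \<subseteq> C" and uv: "adj u v" and f: "f \<in> edges X" "{u, v} \<inter> f = {}"
    using assms by (auto simp: opposite_edges_def)
  have "u \<in> C" using C(2) by simp
  then obtain a b c where s: "sq u a c b" "C = {u, a, c, b}"
      "{e \<in> edges X. u \<in> e \<and> e \<subseteq> C} = {{u, a}, {u, b}}"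
    by (rule square_chart_at[OF C(1)])
  have d: "distinct [u, a, c, b]" by (rule sq_distinct[OF s(1)])
  have "{u, v} \<in> {{u, a}, {u, b}}" unfolding s(3)[symmetric] using uv C(2) by simp
  then have v: "v = a \<or> v = b" by (auto simp: doubleton_eq_iff)
  have "card f = 2" using f by (simp add: edges_def)
  then obtain p q where pq: "f = {p, q}" "p \<noteq> q" by (auto simp: card_2_iff)
  from v show thesis
  proof
    assume "v = a"
    then have "f = {b, c}" using pq f(2) C(3) s(2) d by auto
    then show thesis using that[of b c] s \<open>v = a\<close> by simp
  next
    assume "v = b"
    then have "f = {a, c}" using pq f(2) C(3) s(2) d by auto
    then show thesis using that[of a c] sq_flip[OF s(1)] \<open>v = b\<close> by simp
  qed
qed

lemma sq_opposite: "sq u v y x \<Longrightarrow> opposite_edges X {u, v} {x, y}"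
  using sq_distinct[of u v y x] unfolding sq_def opposite_edges_def 
  by (auto simp: insert_commute intro!: bexI[of _ "{u,v,y,x}"])

lemma adj_link: assumes "adj v a" shows "{{v, a}} \<in> vertex_link X v"
proof -
  have "{e \<in> edges X. v \<in> e \<and> e \<subseteq> {v, a}} = {{v, a}}"
  proof (intro subset_antisym subsetI)
    fix e assume "e \<in> {e \<in> edges X. v \<in> e \<and> e \<subseteq> {v, a}}"
    then have e: "card e = 2" "e \<subseteq> {v, a}" by (auto simp: edges_def)
    moreover have "card {v, a} = 2" using assms by (simp add: edges_def)
    ultimately show "e \<in> {{v, a}}" using card_subset_eq[of "{v, a}" e] by simp
  qed (use assms in auto)
  moreover have "{v, a} \<in> {C \<in> X. v \<in> C}" using assms by (simp add: edges_def)
  ultimately show ?thesis by (intro link_memI) auto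
qed

lemma link_verts: "\<Union>(vertex_link X v) = {e \<in> edges X. v \<in> e}"
  unfolding vertex_link_def edges_def by auto

end

lemma flag_complexD:
  "flag_complex K \<Longrightarrow> finite S \<Longrightarrow> S \<subseteq> \<Union>K \<Longrightarrow> \<forall>x\<in>S. \<forall>y\<in>S. {x, y} \<in> K \<Longrightarrow> S \<in> K"
  by (drule flag_complex_def[THEN iffD1], drule spec[of _ S], erule mp, intro conjI)

locale flag_cubes = cubes X for X :: "'v set set" +
  assumes flag: "\<And>v. v \<in> verts X \<Longrightarrow> flag_complex (vertex_link X v)"
begin

text \<open>
  The 3-cube condition. The three edges are pairwise adjacent in the link of \<open>v\<close>, so by flagness
  they are the edges at \<open>v\<close> of one cube; the given squares are its faces at \<open>v\<close>, and the new ones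
  are the faces at the opposite corner \<open>t\<close>.
\<close>

lemma cube3:
  assumes s: "sq v a p b" "sq v b q c" "sq v c r a"
  obtains t where "sq a p t r" "sq b q t p" "sq c r t q"
proof -
  have e: "adj v a" "adj v b" "adj v c" using s by (auto simp: sq_def)
  have d: "a \<noteq> b" "b \<noteq> c" "c \<noteq> a" using s sq_distinct by fastforce+
  let ?S = "{{v, a}, {v, b}, {v, c}}"
  have "\<forall>x\<in>?S. \<forall>y\<in>?S. {x, y} \<in> vertex_link X v"
    using sq_link[OF s(1)] sq_link[OF s(2)] sq_link[OF s(3)] e[THEN adj_link]
    by (auto simp: insert_commute)
  moreover have "?S \<subseteq> \<Union>(vertex_link X v)" using e by (auto simp: link_verts)
  ultimately have "?S \<in> vertex_link X v"
    by (intro flag_complexD[OF flag[OF adj_verts(1)[OF e(1)]]]) simp_all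
  then obtain C where C: "C \<in> X" "v \<in> C" and S: "?S = {e \<in> edges X. v \<in> e \<and> e \<subseteq> C}"
    unfolding vertex_link_def by (elim imageE CollectE conjE)
  obtain n \<phi> where ch: "cube_chart X C n \<phi>" "\<phi> {} = v" by (rule cube_chart_at[OF C])
  have im: "(\<lambda>i. {v, \<phi> {i}}) ` {..<n} = ?S" unfolding S by (rule chart_edges_at[OF ch, symmetric])
  have ex: "\<exists>i<n. \<phi> {i} = x" if "{v, x} \<in> ?S" for x
  proof -
    have "{v, x} \<in> (\<lambda>i. {v, \<phi> {i}}) ` {..<n}" using that unfolding im .
    then show ?thesis by (auto simp: doubleton_eq_iff)
  qed
  obtain i where i: "i < n" "\<phi> {i} = a" using ex[of a] by auto
  obtain j where j: "j < n" "\<phi> {j} = b" using ex[of b] by auto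
  obtain k where k: "k < n" "\<phi> {k} = c" using ex[of c] by auto
  note ijk = i j k
  then have d': "i \<noteq> j" "j \<noteq> k" "k \<noteq> i" using d by auto
  note cs = chart_sq[OF ch(1)]
  have "sq (\<phi> {}) (\<phi> {i}) (\<phi> {i,j}) (\<phi> {j})" "sq (\<phi> {}) (\<phi> {j}) (\<phi> {j,k}) (\<phi> {k})"
     "sq (\<phi> {}) (\<phi> {k}) (\<phi> {k,i}) (\<phi> {i})"
    by (rule cs; use d' ijk in auto)+
  then have p: "p = \<phi> {i,j}" and q: "q = \<phi> {j,k}" and r: "r = \<phi> {k,i}"
    using s unfolding ijk ch(2) by (blast intro: sq_unique_opp)+
  have "sq (\<phi> {i}) (\<phi> {j,i}) (\<phi> {j,k,i}) (\<phi> {k,i})" "sq (\<phi> {j}) (\<phi> {k,j}) (\<phi> {k,i,j}) (\<phi> {i,j})"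
     "sq (\<phi> {k}) (\<phi> {i,k}) (\<phi> {i,j,k}) (\<phi> {j,k})"
    by (rule cs; use d' ijk in auto)+
  then show thesis using that[of "\<phi> {i,j,k}"] ijk p q r by (simp add: insert_commute)
qed

end

section \<open>Edge paths up to square moves\<close>

context flag_cubes
begin

text \<open>
  Paths are lists read from their current endpoint backwards: extending a path is \<open>Cons\<close>, and the
  constant starting point is the last entry.
\<close>

inductive swap1 :: "'v list \<Rightarrow> 'v list \<Rightarrow> bool" where
  here: "sq a b c b' \<Longrightarrow> swap1 (a # b # c # l) (a # b' # c # l)"
| later: "swap1 l l' \<Longrightarrow> swap1 (x # l) (x # l')"

abbreviation swaps :: "'v list \<Rightarrow> 'v list \<Rightarrow> bool" (infix "\<simeq>" 50) where
  "l \<simeq> l' \<equiv> swap1\<^sup>*\<^sup>* l l'"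

abbreviation walk :: "'v list \<Rightarrow> bool" where "walk l \<equiv> edge_path X l"

lemma swap1_sym: "swap1 l l' \<Longrightarrow> swap1 l' l"
  by (induction rule: swap1.induct) (auto intro: swap1.intros sq_flip)

lemma swaps_sym: "l \<simeq> l' \<Longrightarrow> l' \<simeq> l"
  by (metis sympD sympI swap1_sym symp_rtranclp)

lemma swaps_Cons: "l \<simeq> l' \<Longrightarrow> x # l \<simeq> x # l'"
  by (induction rule: rtranclp_induct) (auto intro: swap1.later rtranclp.rtrancl_into_rtrancl)

lemma swaps_here: "sq a b c b' \<Longrightarrow> a # b # c # l \<simeq> a # b' # c # l"
  by (auto intro: swap1.here)

lemma swap1_length: "swap1 l l' \<Longrightarrow> length l = length l'"
  by (induction rule: swap1.induct) auto

lemma swaps_length: "l \<simeq> l' \<Longrightarrow> length l = length l'"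
  by (induction rule: rtranclp_induct) (auto dest: swap1_length)

lemma swap1_hd: "swap1 l l' \<Longrightarrow> l \<noteq> [] \<and> l' \<noteq> [] \<and> hd l = hd l' \<and> last l = last l'"
  by (induction rule: swap1.induct) auto

lemma swaps_hd: "l \<simeq> l' \<Longrightarrow> hd l = hd l' \<and> last l = last l'"
  by (induction rule: rtranclp_induct) (auto dest: swap1_hd)

lemma walk_simps:
  "walk [x] \<longleftrightarrow> x \<in> verts X"
  "walk (x # y # l) \<longleftrightarrow> adj x y \<and> walk (y # l)"
  by (auto simp: edge_path_def adj_verts)

lemma walk_Cons: "walk (x # l) \<longleftrightarrow> (if l = [] then x \<in> verts X else adj x (hd l) \<and> walk l)"
  by (cases l) (auto simp: walk_simps)

lemma swap1_walk: "swap1 l l' \<Longrightarrow> walk l \<Longrightarrow> walk l'"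
proof (induction rule: swap1.induct)
  case (here a b c b' l)
  then show ?case by (auto simp: walk_simps sq_def insert_commute)
next
  case (later l l' x)
  then show ?case using swap1_hd[OF later(1)] by (auto simp: walk_Cons)
qed

lemma swaps_walk: "l \<simeq> l' \<Longrightarrow> walk l \<Longrightarrow> walk l'"
  by (induction rule: rtranclp_induct) (auto dest: swap1_walk)

text \<open>
  The key to everything that follows: if two paths to \<open>x\<close> differ by square moves, then either they
  end with the same edge and already their initial parts differ by square moves, or their last edges
  span a square and both paths can be made to run through its fourth corner \<open>z\<close>.

  The proof is by induction on the length and then on the number of moves. When a move on the last
  square changes an earlier last vertex \<open>w''\<close> into \<open>w'\<close>, the path to \<open>w''\<close> has two descriptions,
  through \<open>z1\<close> and through \<open>z''\<close>. The shorter case applied to these yields a third square at \<open>w''\<close>;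
  the three squares bound a 3-cube, and the square required at \<open>x\<close> is one of its faces.
\<close>

lemma last_edges:
  assumes "x # w # q \<simeq> x # w' # q'"
  shows "w = w' \<and> w # q \<simeq> w' # q' \<or>
    (\<exists>z r. sq w x w' z \<and> w # q \<simeq> w # z # r \<and> w' # q' \<simeq> w' # z # r)"
  using assms
proof (induction "length q" arbitrary: x w q w' q' rule: less_induct)
  case less
  let ?P = "\<lambda>w' q'. w = w' \<and> w # q \<simeq> w' # q' \<or>
    (\<exists>z r. sq w x w' z \<and> w # q \<simeq> w # z # r \<and> w' # q' \<simeq> w' # z # r)"
  have "\<forall>w' q'. p = x # w' # q' \<longrightarrow> ?P w' q'" if "x # w # q \<simeq> p" for p
    using that
  proof (induction rule: rtranclp_induct)
    case base
    then show ?case by auto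
  next
    case (step p p')
    show ?case
    proof (intro allI impI)
      fix w' q' assume p': "p' = x # w' # q'"
      have len: "length p = Suc (Suc (length q))" using swaps_length[OF step(1)] by simp
      have "hd p = x" using swap1_hd[OF step(2)] p' by simp
      then obtain w'' q'' where p: "p = x # w'' # q''" using len by (cases p; cases "tl p") auto
      have lq: "length q'' = length q" using len p by simp
      have IH: "?P w'' q''" using step.IH p by blast
      have sw: "swap1 (x # w'' # q'') (x # w' # q')" using step(2) p p' by simp
      then show "?P w' q'"
      proof (cases rule: swap1.cases)
        case later
        then have s: "swap1 (w'' # q'') (w' # q')" by simp
        then have "w'' = w'" using swap1_hd by fastforce
        then show ?thesis using IH s
          by (metis rtranclp.rtrancl_into_rtrancl rtranclp_trans swap1_sym converse_rtranclp_into_rtranclp)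
      next
        case (here z'' r'')
        then have q'': "q'' = z'' # r''" and q': "q' = z'' # r''" and sq1: "sq x w'' z'' w'" by auto
        have len_r: "length r'' < length q" using lq q'' by simp
        from IH show ?thesis
        proof
          assume a: "w = w'' \<and> w # q \<simeq> w'' # q''"
          then have "sq w x w' z''" using sq1 by (metis sq_flip sq_rot)
          then show ?thesis using a q' q'' by blast
        next
          assume "\<exists>z r. sq w x w'' z \<and> w # q \<simeq> w # z # r \<and> w'' # q'' \<simeq> w'' # z # r"
          then obtain z1 r1 where b: "sq w x w'' z1" "w # q \<simeq> w # z1 # r1" "w'' # q'' \<simeq> w'' # z1 # r1"
            by blast
          have "w'' # z'' # r'' \<simeq> w'' # z1 # r1" using b(3) q'' by simp
          from less.hyps[OF len_r this] show ?thesis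
          proof
            assume c: "z'' = z1 \<and> z'' # r'' \<simeq> z1 # r1"
            \<comment> \<open>the two squares at \<open>w''\<close> share three vertices, so they coincide\<close>
            have "sq x w'' z1 w" using b(1) by (metis sq_flip sq_rot)
            then have "w = w'" using sq1 c sq_unique by blast
            moreover have "w # q \<simeq> w' # q'"
              using b(2) swaps_sym[OF swaps_Cons, of "z'' # r''" "z1 # r1" w'] c q' calculation
              by (metis rtranclp_trans)
            ultimately show ?thesis by blast
          next
            assume "\<exists>y r. sq z'' w'' z1 y \<and> z'' # r'' \<simeq> z'' # y # r \<and> z1 # r1 \<simeq> z1 # y # r"
            then obtain y r2 where c: "sq z'' w'' z1 y" "z'' # r'' \<simeq> z'' # y # r2" "z1 # r1 \<simeq> z1 # y # r2"
              by blast
            have "sq w'' x w z1" "sq w'' z1 y z''" "sq w'' z'' w' x"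
              using b(1) c(1) sq1 by (metis sq_flip sq_rot)+
            \<comment> \<open>\<open>t\<close> is the corner of the 3-cube opposite to \<open>w''\<close>\<close>
            then obtain t where t: "sq x w t w'" "sq z1 y t w" "sq z'' w' t y"
              by (rule cube3)
            have t': "sq w x w' t" "sq w t y z1" "sq w' t y z''" using t by (metis sq_flip sq_rot)+
            have "w # q \<simeq> w # t # y # r2"
              using b(2) swaps_Cons[OF c(3), of w] swaps_here[OF sq_flip[OF t'(2)], of r2]
              by (metis rtranclp_trans)
            moreover have "w' # q' \<simeq> w' # t # y # r2"
              using swaps_Cons[OF c(2), of w'] swaps_here[OF sq_flip[OF t'(3)], of r2] q'
              by (metis rtranclp_trans)
            ultimately show ?thesis using t'(1) by blast
          qed
        qed
      qed
    qed
  qed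
  then show ?case using less.prems by blast
qed

lemma swaps_ConsD: "x # w # q \<simeq> x # w # q' \<Longrightarrow> w # q \<simeq> w # q'"
  using last_edges[of x w q w q'] sq_distinct by fastforce

definition reduced :: "'v list \<Rightarrow> bool" where
  "reduced l \<longleftrightarrow> (\<forall>p u v q. \<not> l \<simeq> p @ [u, v, u] @ q)"

lemma reduced_cong: "l \<simeq> l' \<Longrightarrow> reduced l \<Longrightarrow> reduced l'"
  unfolding reduced_def by (meson rtranclp_trans)

lemma reduced_ConsD: "reduced (x # l) \<Longrightarrow> reduced l"
  unfolding reduced_def by (metis append_Cons swaps_Cons)

lemma reduced_sing: "reduced [x]"
  using swaps_length unfolding reduced_def by fastforce

lemma swaps_length1: "x # l \<simeq> p \<Longrightarrow> \<exists>l'. p = x # l' \<and> length l' = length l"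
  using swaps_length[of "x # l" p] swaps_hd[of "x # l" p] by (cases p) auto

text \<open>
  An appended edge creates a backtrack only if the path could already end with that edge. Given
  a backtrack after appending \<open>w\<close>, \<open>last_edges\<close> exhibits a square at \<open>w\<close>, and the same situation
  occurs one edge earlier on the opposite side of this square.
\<close>

lemma reduced_Cons:
  assumes "reduced (x # l)" "\<not> (\<exists>q. x # l \<simeq> x # w # q)" "x \<noteq> w"
  shows "reduced (w # x # l)"
  using assms
proof (induction "length l" arbitrary: x l w rule: less_induct)
  case less
  show ?case
  proof (rule ccontr)
    assume "\<not> reduced (w # x # l)"
    then obtain p u v q where s: "w # x # l \<simeq> p @ [u, v, u] @ q" by (auto simp: reduced_def)
    obtain t s' where ts: "p @ [u, v, u] @ q = w # t # s'"
      using swaps_length1[OF s] by (cases p; cases "tl p") auto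
    \<comment> \<open>the backtrack either contains the last edge or lies in the rest of the path\<close>
    have bt: "(\<exists>q'. s' = w # q') \<or> \<not> reduced (t # s')"
    proof (cases p)
      case Nil then show ?thesis using ts by auto
    next
      case (Cons a p') then have "t # s' = p' @ [u, v, u] @ q" using ts by simp
      then show ?thesis unfolding reduced_def by (metis rtranclp.rtrancl_refl)
    qed
    have s: "w # x # l \<simeq> w # t # s'" using s ts by simp
    from last_edges[OF s] show False
    proof
      assume a: "x = t \<and> x # l \<simeq> t # s'"
      then show False using bt less.prems reduced_cong by blast
    next
      assume "\<exists>z r. sq x w t z \<and> x # l \<simeq> x # z # r \<and> t # s' \<simeq> t # z # r"
      then obtain z r where z: "sq x w t z" "x # l \<simeq> x # z # r" "t # s' \<simeq> t # z # r" by blast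
      have d: "distinct [x, w, t, z]" by (rule sq_distinct[OF z(1)])
      have red_zr: "reduced (z # r)" using reduced_cong[OF z(2) less.prems(1)] reduced_ConsD by blast
      have len: "length r < length l" using swaps_length[OF z(2)] by simp
      show False
      proof (cases "\<exists>q. z # r \<simeq> z # t # q")
        case True
        then obtain q where q: "z # r \<simeq> z # t # q" by blast
        have "sq x z t w" using z(1) by (metis sq_flip)
        then have "x # l \<simeq> x # w # t # q"
          using z(2) swaps_Cons[OF q, of x] swaps_here[of x z t w q] by (metis rtranclp_trans)
        then show False using less.prems(2) by blast
      next
        case False
        have "reduced (t # z # r)" using less.hyps[OF len red_zr False] d by auto
        then have "reduced (t # s')" using reduced_cong swaps_sym[OF z(3)] by blast
        then obtain q' where "s' = w # q'" using bt by blast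
        then have "t # w # q' \<simeq> t # z # r" using z(3) by simp
        from last_edges[OF this] obtain y r' where
          y: "sq w t z y" "z # r \<simeq> z # y # r'" using d by auto
        have "sq w t z x" using z(1) by (metis sq_flip sq_rot)
        then have "y = x" using y(1) sq_unique by blast
        then have "x # l \<simeq> [] @ [x, z, x] @ r'"
          using z(2) swaps_Cons[OF y(2), of x] by (metis append_Cons append_Nil rtranclp_trans)
        then show False using less.prems(1) unfolding reduced_def by blast
      qed
    qed
  qed
qed

text \<open>
  Extending a path by the vertex \<open>w\<close> and reducing: if square moves can bring the edge from \<open>w\<close> to
  the end, it cancels, and otherwise it is appended. The choice of the remaining path matters only
  up to square moves, by \<open>step_cancel\<close>.
\<close>

definition step :: "'v \<Rightarrow> 'v list \<Rightarrow> 'v list" where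
  "step w l = (if \<exists>q. l \<simeq> hd l # w # q then w # (SOME q. l \<simeq> hd l # w # q) else w # l)"

lemma step_cancel: assumes "l \<simeq> hd l # w # q" shows "step w l \<simeq> w # q"
proof -
  have "l \<simeq> hd l # w # (SOME q. l \<simeq> hd l # w # q)" using assms by (rule someI)
  then have "hd l # w # (SOME q. l \<simeq> hd l # w # q) \<simeq> hd l # w # q"
    using assms swaps_sym rtranclp_trans by metis
  then show ?thesis using assms by (auto simp: step_def dest: swaps_ConsD)
qed

lemma step_push: "\<not> (\<exists>q. l \<simeq> hd l # w # q) \<Longrightarrow> step w l = w # l"
  unfolding step_def by simp

lemma hd_step [simp]: "hd (step w l) = w"
  by (simp add: step_def)

lemma step_cong: assumes "l \<simeq> l'" shows "step w l \<simeq> step w l'"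
proof (cases "\<exists>q. l \<simeq> hd l # w # q")
  case True
  then obtain q where q: "l \<simeq> hd l # w # q" by blast
  have h: "hd l' = hd l" using swaps_hd[OF assms] by simp
  then have "l' \<simeq> hd l' # w # q" using q assms swaps_sym rtranclp_trans by metis
  then show ?thesis using step_cancel[OF q] step_cancel swaps_sym rtranclp_trans by metis
next
  case False
  have h: "hd l' = hd l" using swaps_hd[OF assms] by simp
  then have "\<not> (\<exists>q. l' \<simeq> hd l' # w # q)" using False assms rtranclp_trans by metis
  then show ?thesis using False assms by (simp add: step_push swaps_Cons)
qed

lemma step_walk_reduced:
  assumes "walk l" "reduced l" "adj (hd l) w"
  shows "walk (step w l)" "reduced (step w l)"
proof -
  have ne: "l \<noteq> []" using assms by (simp add: edge_path_def)
  then obtain x m where l: "l = x # m" by (cases l) auto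
  have "walk (step w l) \<and> reduced (step w l)"
  proof (cases "\<exists>q. l \<simeq> hd l # w # q")
    case True
    then obtain q where q: "l \<simeq> hd l # w # q" by blast
    then have "walk (w # q)" "reduced (w # q)"
      using swaps_walk[OF q] reduced_cong[OF q] assms reduced_ConsD by (auto simp: walk_simps)
    then show ?thesis using step_cancel[OF q] swaps_sym swaps_walk reduced_cong by blast
  next
    case False
    then have "reduced (w # l)" using reduced_Cons[of x m w] assms l adj_neq by auto
    moreover have "walk (w # l)" using assms l adj_sym by (auto simp: walk_simps)
    ultimately show ?thesis using False by (simp add: step_push)
  qed
  then show "walk (step w l)" "reduced (step w l)" by auto
qed

lemma step_back:
  assumes "walk l" "reduced l" "adj (hd l) w"
  shows "step (hd l) (step w l) \<simeq> l"
proof -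
  obtain x m where l: "l = x # m" using assms by (cases l) (auto simp: edge_path_def)
  show ?thesis
  proof (cases "\<exists>q. l \<simeq> hd l # w # q")
    case True
    then obtain q where q: "l \<simeq> x # w # q" using l by auto
    have st: "step w l \<simeq> w # q" using step_cancel[of l w q] q l by simp
    have "\<not> (\<exists>q'. w # q \<simeq> w # x # q')"
    proof
      assume "\<exists>q'. w # q \<simeq> w # x # q'"
      then obtain q' where "w # q \<simeq> w # x # q'" by blast
      then have "l \<simeq> [] @ [x, w, x] @ q'" using q swaps_Cons[of "w # q" _ x] rtranclp_trans by fastforce
      then show False using assms(2) unfolding reduced_def by blast
    qed
    then have "step x (w # q) = x # w # q" by (intro step_push) simp
    then show ?thesis using step_cong[OF st, of x] q swaps_sym l by (metis list.sel(1) rtranclp_trans)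
  next
    case False
    then have "step w l = w # l" by (rule step_push)
    moreover have "step x (w # l) \<simeq> x # m" by (rule step_cancel) (simp add: l)
    ultimately show ?thesis using l by simp
  qed
qed

text \<open>
  The square has its corner \<open>hd l\<close> at the end of the path. If the edge to \<open>v\<close> cancels while the
  edge to \<open>v'\<close> is appended, then afterwards the edge to \<open>w\<close> is appended on the one side and cancels
  on the other.
\<close>

lemma step_sq_cancel_push:
  assumes l: "walk l" "reduced l" and sq: "sq (hd l) v w v'"
    and v: "l \<simeq> hd l # v # q" and v': "\<not> (\<exists>q. l \<simeq> hd l # v' # q)"
  shows "step w (step v l) \<simeq> step w (step v' l)"
proof -
  obtain u m where u: "l = u # m" using l by (cases l) (auto simp: edge_path_def)
  have st: "step v l \<simeq> v # q" using step_cancel[OF v] .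
  have sqs: "sq v' u v w" "sq u v w v'" using sq u by (auto intro: sq_rot sq_flip)
  have "\<not> (\<exists>q'. v # q \<simeq> v # w # q')"
  proof
    assume "\<exists>q'. v # q \<simeq> v # w # q'"
    then obtain q' where "v # q \<simeq> v # w # q'" by blast
    then have "l \<simeq> u # v' # w # q'"
      using v u swaps_Cons[of "v # q" _ u] swaps_here[OF sqs(2), of q'] rtranclp_trans
      by (metis list.sel(1))
    then show False using v' u by auto
  qed
  then have "step w (v # q) = w # v # q" by (intro step_push) simp
  then have 1: "step w (step v l) \<simeq> w # v # q" using step_cong[OF st, of w] by simp
  have "step v' l = v' # l" using v' by (rule step_push)
  also have "v' # l \<simeq> v' # u # v # q" using swaps_Cons[OF v, of v'] u by simp
  also have "v' # u # v # q \<simeq> v' # w # v # q" by (rule swaps_here[OF sqs(1)])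
  finally have "step v' l \<simeq> hd (step v' l) # w # v # q" by simp
  from step_cancel[OF this] have "step w (step v' l) \<simeq> w # v # q" .
  then show ?thesis using 1 swaps_sym rtranclp_trans by metis
qed

text \<open>
  Together with \<open>step_back\<close> this says that stepping respects the elementary moves of homotopy. The
  four cases record which of the two first edges cancel.
\<close>

lemma step_sq:
  assumes l: "walk l" "reduced l" and sq: "sq (hd l) v w v'"
  shows "step w (step v l) \<simeq> step w (step v' l)"
proof -
  obtain u m where u: "l = u # m" using l by (cases l) (auto simp: edge_path_def)
  have squ: "sq u v w v'" "sq v u v' w" "sq w v u v'"
    using sq u by (auto intro: sq_rot sq_flip)
  have d: "distinct [u, v, w, v']" using sq_distinct[OF squ(1)] .
  consider (both) q q' where "l \<simeq> u # v # q" "l \<simeq> u # v' # q'"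
    | (left) q where "l \<simeq> u # v # q" "\<not> (\<exists>q. l \<simeq> u # v' # q)"
    | (right) q where "l \<simeq> u # v' # q" "\<not> (\<exists>q. l \<simeq> u # v # q)"
    | (neither) "\<not> (\<exists>q. l \<simeq> u # v # q)" "\<not> (\<exists>q. l \<simeq> u # v' # q)"
    by blast
  then show ?thesis
  proof cases
    case both
    then have "u # v # q \<simeq> u # v' # q'" using swaps_sym rtranclp_trans by metis
    from last_edges[OF this] d obtain z r where
      z: "sq v u v' z" "v # q \<simeq> v # z # r" "v' # q' \<simeq> v' # z # r" by auto
    have "z = w" using z(1) squ(2) sq_unique by blast
    have "step v l \<simeq> v # w # r" "step v' l \<simeq> v' # w # r"
      using step_cancel[of l v q] step_cancel[of l v' q'] both z \<open>z = w\<close> u rtranclp_trans by fastforce+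
    then have "step v l \<simeq> hd (step v l) # w # r" "step v' l \<simeq> hd (step v' l) # w # r" by simp_all
    then show ?thesis using step_cancel swaps_sym rtranclp_trans by metis
  next
    case left
    then show ?thesis using step_sq_cancel_push[OF l sq] u by simp
  next
    case right
    then show ?thesis using step_sq_cancel_push[OF l sq_flip[OF sq]] u swaps_sym by simp
  next
    case neither
    have st: "step v l = v # l" "step v' l = v' # l" using neither u by (auto intro!: step_push)
    have no: "\<not> (\<exists>q. a # l \<simeq> a # w # q)" if nb: "\<not> (\<exists>q. l \<simeq> u # b # q)" and sab: "sq w a u b" for a b
    proof
      assume "\<exists>q. a # l \<simeq> a # w # q"
      then obtain q where "a # u # m \<simeq> a # w # q" using u by auto
      \<comment> \<open>cancelling \<open>w\<close> after \<open>a\<close> would make \<open>l\<close> end with the edge to the fourth corner \<open>b\<close>\<close>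
      from last_edges[OF this] obtain z r where z: "sq u a w z" "u # m \<simeq> u # z # r"
        using sq_distinct[OF sab] by auto
      have "sq u a w b" using sab by (metis sq_flip sq_rot)
      then have "z = b" using z sq_unique by blast
      then show False using z nb u by auto
    qed
    have "step w (v # l) = w # v # l" "step w (v' # l) = w # v' # l"
      using no[OF neither(2) squ(3)] no[OF neither(1) sq_flip[OF squ(3)]] by (auto intro!: step_push)
    moreover have "w # v # l \<simeq> w # v' # l" unfolding u by (rule swaps_here[OF squ(3)])
    ultimately show ?thesis using st by simp
  qed
qed

end

section \<open>Homotopy, geodesics and the quadrangle condition\<close>

context flag_cubes
begin

text \<open>
  The path is now read in its own direction; its reduct is a reversed list as before.
\<close>

definition reduct :: "'v list \<Rightarrow> 'v list" where
  "reduct p = fold step (tl p) [hd p]"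

lemma fold_step_cong: "l \<simeq> l' \<Longrightarrow> fold step p l \<simeq> fold step p l'"
  by (induction p arbitrary: l l') (auto intro: step_cong)

lemma hd_fold_step: "l \<noteq> [] \<Longrightarrow> hd (fold step p l) = last (hd l # p)"
  by (induction p arbitrary: l) (auto simp: step_def)

lemma fold_step_ok:
  "walk l \<Longrightarrow> reduced l \<Longrightarrow> walk (hd l # p) \<Longrightarrow> walk (fold step p l) \<and> reduced (fold step p l)"
proof (induction p arbitrary: l)
  case (Cons w p)
  then have "adj (hd l) w" "walk (w # p)" by (auto simp: walk_simps)
  then show ?case using Cons.IH[of "step w l"] step_walk_reduced[OF Cons.prems(1,2)] by simp
qed simp

lemma walk_append:
  "walk (p @ q) \<longleftrightarrow> (if p = [] then walk q else if q = [] then walk p else walk p \<and> adj (last p) (hd q) \<and> walk q)"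
  by (auto simp: edge_path_def successively_append_iff)

lemma walk_rev: "walk (rev l) \<longleftrightarrow> walk l"
  by (auto simp: edge_path_def successively_rev insert_commute)

lemma reduct_append: "p \<noteq> [] \<Longrightarrow> reduct (p @ q) = fold step q (reduct p)"
  by (simp add: reduct_def)

lemma reduct_ok:
  assumes "walk p" shows "walk (reduct p)" "reduced (reduct p)" "hd (reduct p) = last p"
proof -
  have ne: "p \<noteq> []" using assms by (auto simp: edge_path_def)
  have "walk [hd p]" using assms ne by (auto simp: edge_path_def)
  then show "walk (reduct p)" "reduced (reduct p)"
    using fold_step_ok[of "[hd p]" "tl p"] reduced_sing assms ne by (auto simp: reduct_def)
  show "hd (reduct p) = last p" using ne by (simp add: reduct_def hd_fold_step)
qed

lemma reduct_elem_move:
  assumes "elem_move X p q" shows "reduct p \<simeq> reduct q \<and> hd p = hd q"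
  using assms
proof (cases rule: elem_move.cases)
  case (backtrack s u v t)
  have w: "walk (s @ [u, v, u] @ t)" using backtrack by simp
  then have wsu: "walk (s @ [u])" "adj u v" by (auto simp: walk_append walk_simps adj_verts split: if_splits)
  note tr = reduct_ok[OF wsu(1)]
  have "reduct p = fold step t (step u (step v (reduct (s @ [u]))))"
    using reduct_append[of "s @ [u]" "[v, u] @ t"] backtrack by simp
  moreover have "reduct q = fold step t (reduct (s @ [u]))"
    using reduct_append[of "s @ [u]" t] backtrack by simp
  moreover have "step u (step v (reduct (s @ [u]))) \<simeq> reduct (s @ [u])"
    using step_back[OF tr(1,2), of v] tr(3) wsu by simp
  moreover have "hd p = hd q" using backtrack by (cases s) auto
  ultimately show ?thesis by (simp add: fold_step_cong)
next
  case (square s u v w t v')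
  have "walk (s @ [u, v, w] @ t)" "walk (s @ [u, v', w] @ t)" using square by auto
  then have wsu: "walk (s @ [u])" "adj u v" "adj v w" "adj u v'" "adj v' w"
    by (auto simp: walk_append walk_simps adj_verts split: if_splits)
  note tr = reduct_ok[OF wsu(1)]
  have "sq u v w v'" using square wsu by (auto simp: sq_def insert_commute)
  then have "step w (step v (reduct (s @ [u]))) \<simeq> step w (step v' (reduct (s @ [u])))"
    using step_sq[OF tr(1,2)] tr(3) by simp
  moreover have "reduct p = fold step t (step w (step v (reduct (s @ [u]))))"
    using reduct_append[of "s @ [u]" "[v, w] @ t"] square by simp
  moreover have "reduct q = fold step t (step w (step v' (reduct (s @ [u]))))"
    using reduct_append[of "s @ [u]" "[v', w] @ t"] square by simp
  moreover have "hd p = hd q" using square by (cases s) auto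
  ultimately show ?thesis by (simp add: fold_step_cong)
qed

lemma reduct_homotopic: "path_homotopic X p q \<Longrightarrow> reduct p \<simeq> reduct q"
  unfolding path_homotopic_def
proof (induction rule: equivclp_induct)
  case (step y z)
  then show ?case using reduct_elem_move swaps_sym rtranclp_trans by metis
qed simp

lemma fold_step_back:
  assumes "walk l" "reduced l" "walk (hd l # p)"
  shows "fold step (tl (rev (hd l # p))) (fold step p l) \<simeq> l"
  using assms
proof (induction p arbitrary: l)
  case (Cons w p)
  then have a: "adj (hd l) w" "walk (w # p)" by (auto simp: walk_simps)
  have "tl (rev (hd l # w # p)) = tl (rev (w # p)) @ [hd l]" by (cases "rev p") auto
  then have "fold step (tl (rev (hd l # w # p))) (fold step (w # p) l) =
      step (hd l) (fold step (tl (rev (w # p))) (fold step p (step w l)))" by simp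
  moreover have "fold step (tl (rev (w # p))) (fold step p (step w l)) \<simeq> step w l"
    using Cons.IH[of "step w l"] step_walk_reduced[OF Cons.prems(1,2) a(1)] a(2) by simp
  ultimately show ?case
    using step_back[OF Cons.prems(1,2) a(1)] step_cong rtranclp_trans by metis
qed simp

lemma reduct_rev_reduced: "walk l \<Longrightarrow> reduced l \<Longrightarrow> reduct (rev l) = l"
proof (induction l)
  case (Cons w l)
  show ?case
  proof (cases "l = []")
    case True then show ?thesis by (simp add: reduct_def)
  next
    case False
    then obtain x m where l: "l = x # m" by (cases l) auto
    have "reduct (rev l) = l" using Cons reduced_ConsD False by (auto simp: walk_Cons)
    then have "reduct (rev (w # l)) = step w l" using reduct_append[of "rev l" "[w]"] False by simp
    also have "\<dots> = w # l"
    proof (rule step_push, rule notI)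
      assume "\<exists>q. l \<simeq> hd l # w # q"
      then obtain q where "w # l \<simeq> [] @ [w, x, w] @ q" using swaps_Cons l by fastforce
      then show False using Cons.prems(2) unfolding reduced_def by blast
    qed
    finally show ?thesis .
  qed
qed (auto simp: edge_path_def)

end

locale cat0_cubes = flag_cubes X for X :: "'v set set" +
  assumes sc: "edge_simply_connected X"
begin

abbreviation d :: "'v \<Rightarrow> 'v \<Rightarrow> nat" where "d \<equiv> comb_dist X"

text \<open>
  Go along \<open>p\<close> and back along \<open>q\<close>: this loop is null-homotopic, so it reduces to the trivial path.
  Stepping along \<open>q\<close> once more undoes the way back.
\<close>

lemma reduct_unique:
  assumes "walk p" "walk q" "hd p = hd q" "last p = last q"
  shows "reduct p \<simeq> reduct q"
proof -
  have ne: "p \<noteq> []" "q \<noteq> []" using assms by (auto simp: edge_path_def)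
  have wr: "walk (rev q)" using assms by (simp add: walk_rev)
  obtain z q' where q': "rev q = z # q'" using ne by (cases "rev q") auto
  have z: "z = last q" using q' by (metis hd_rev list.sel(1))
  let ?c = "p @ q'"
  have "walk ?c" "last ?c = hd q"
  proof -
    show "walk ?c" using assms(1,4) wr q' z by (auto simp: walk_append walk_Cons split: if_splits)
    have "last (rev q) = hd q" using ne by (simp add: last_rev)
    then show "last ?c = hd q" using q' z assms(4) by (auto split: if_splits)
  qed
  moreover have "hd ?c = hd q" using ne assms by simp
  ultimately have "path_homotopic X ?c [hd q]" using sc unfolding edge_simply_connected_def by metis
  then have "reduct ?c \<simeq> reduct [hd q]" by (rule reduct_homotopic)
  then have "fold step q' (reduct p) \<simeq> [hd q]" by (simp add: reduct_append ne) (simp add: reduct_def)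
  then have 1: "fold step (tl q) (fold step q' (reduct p)) \<simeq> reduct q"
    unfolding reduct_def[of q] by (rule fold_step_cong)
  note tr = reduct_ok[OF assms(1)]
  have "walk (hd (reduct p) # q')" using wr q' z tr(3) assms(4) by simp
  then have "fold step (tl (rev (hd (reduct p) # q'))) (fold step q' (reduct p)) \<simeq> reduct p"
    by (rule fold_step_back[OF tr(1,2)])
  moreover have "rev (hd (reduct p) # q') = q" using q' z tr(3) assms(4) by (metis rev_rev_ident)
  ultimately have "fold step (tl q) (fold step q' (reduct p)) \<simeq> reduct p" by simp
  then show ?thesis using 1 swaps_sym rtranclp_trans by metis
qed

text \<open>
  A reduced path is its own reduct.
\<close>

lemma reduced_unique:
  assumes "walk l" "reduced l" "walk l'" "reduced l'" "hd l = hd l'" "last l = last l'"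
  shows "l \<simeq> l'"
proof -
  have "l \<noteq> []" "l' \<noteq> []" using assms by (auto simp: edge_path_def)
  then have "reduct (rev l) \<simeq> reduct (rev l')"
    using assms by (intro reduct_unique) (auto simp: walk_rev hd_rev last_rev)
  then show ?thesis using assms by (simp add: reduct_rev_reduced)
qed

lemma dist_le: "walk p \<Longrightarrow> d (hd p) (last p) < length p"
proof -
  assume p: "walk p"
  then have "p \<noteq> []" by (auto simp: edge_path_def)
  then obtain n where n: "length p = Suc n" by (cases p) auto
  have "d (hd p) (last p) \<le> n" unfolding comb_dist_def by (rule Least_le) (use p n in blast)
  then show ?thesis using n by simp
qed

lemma geodesic_exists:
  assumes "u \<in> verts X" "v \<in> verts X"
  obtains p where "walk p" "hd p = u" "last p = v" "length p = Suc (d u v)"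
proof -
  obtain p where p: "walk p" "hd p = u" "last p = v"
    using sc assms unfolding edge_simply_connected_def edge_connected_def by blast
  then obtain n where "length p = Suc n" by (cases p) (auto simp: edge_path_def)
  then have "\<exists>p. walk p \<and> hd p = u \<and> last p = v \<and> length p = Suc n" using p by blast
  then have "\<exists>p. walk p \<and> hd p = u \<and> last p = v \<and> length p = Suc (d u v)"
    unfolding comb_dist_def by (rule LeastI)
  then show thesis using that by blast
qed

lemma shortest_reduced:
  assumes "walk p" "length p = Suc (d (hd p) (last p))"
  shows "reduced p"
  unfolding reduced_def
proof (intro allI notI)
  fix s u v t assume s: "p \<simeq> s @ [u, v, u] @ t"
  have "walk (s @ [u, v, u] @ t)" by (rule swaps_walk[OF s assms(1)])
  then have "walk (s @ [u] @ t)" by (auto simp: walk_append walk_simps split: if_splits)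
  from dist_le[OF this] have "d (hd (s @ [u] @ t)) (last (s @ [u] @ t)) < length (s @ [u] @ t)" .
  moreover have "hd (s @ [u] @ t) = hd p" "last (s @ [u] @ t) = last p"
    using swaps_hd[OF s] by (auto simp: hd_append split: if_splits)
  moreover have "length p = length s + 3 + length t" using swaps_length[OF s] by simp
  ultimately show False using assms(2) by simp
qed

lemma reduced_length:
  assumes "walk l" "reduced l" shows "length l = Suc (d (hd l) (last l))"
proof -
  have "l \<noteq> []" using assms by (auto simp: edge_path_def)
  then have "hd l \<in> verts X" "last l \<in> verts X" using assms by (auto simp: edge_path_def)
  then obtain p where p: "walk p" "hd p = hd l" "last p = last l" "length p = Suc (d (hd l) (last l))"
    by (rule geodesic_exists)
  then have "reduced p" by (intro shortest_reduced) auto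
  then have "l \<simeq> p" using assms p by (intro reduced_unique) auto
  then show ?thesis using swaps_length p by metis
qed

lemma dist_step:
  assumes "x \<in> verts X" "y \<in> verts X" "d x y = Suc n"
  obtains z where "adj x z" "d z y = n"
proof -
  obtain p where p: "walk p" "hd p = x" "last p = y" "length p = Suc (d x y)"
    by (rule geodesic_exists[OF assms(1,2)])
  then obtain z q where q: "p = x # z # q" using assms(3) by (cases p; cases "tl p") auto
  have r: "reduced (z # q)" using shortest_reduced[of p] p q reduced_ConsD by auto
  have "walk (z # q)" "adj x z" using p q by (auto simp: walk_simps)
  moreover have "d z y = n" using reduced_length[OF \<open>walk (z # q)\<close> r] p q assms(3) by simp
  ultimately show thesis using that by blast
qed

text \<open>
  Reduced paths are geodesics, and extending a geodesic by one edge and reducing changes its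
  length by exactly one.
\<close>

lemma dist_bip:
  assumes "adj u v" "y \<in> verts X"
  shows "d u y = Suc (d v y) \<or> d v y = Suc (d u y)"
proof -
  obtain p where p: "walk p" "hd p = u" "last p = y" "length p = Suc (d u y)"
    using geodesic_exists[OF adj_verts(1)[OF assms(1)] assms(2)] .
  then obtain q where q: "p = u # q" by (cases p) auto
  have r: "reduced p" using p by (intro shortest_reduced) auto
  show ?thesis
  proof (cases "\<exists>q'. p \<simeq> u # v # q'")
    case True
    then obtain q' where q': "p \<simeq> u # v # q'" by blast
    then have "walk (v # q')" "reduced (v # q')"
      using swaps_walk[OF q' p(1)] reduced_cong[OF q' r] reduced_ConsD by (auto simp: walk_simps)
    from reduced_length[OF this] show ?thesis
      using swaps_length[OF q'] swaps_hd[OF q'] p by simp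
  next
    case False
    then have "reduced (v # u # q)"
      using r q adj_neq[OF assms(1)] by (intro reduced_Cons) auto
    moreover have "walk (v # u # q)" using p q assms(1) adj_sym by (auto simp: walk_simps)
    ultimately show ?thesis using reduced_length[of "v # u # q"] p q by simp
  qed
qed

text \<open>
  Two geodesics from \<open>x\<close> that start through \<open>w\<close> and \<open>w'\<close> differ by square moves, so
  \<open>last_edges\<close> applies to them.
\<close>

lemma quadrangle_square:
  assumes "y \<in> verts X" "adj x w" "adj x w'" "w \<noteq> w'" "d x y = Suc (d w y)" "d x y = Suc (d w' y)"
  obtains z where "sq x w z w'" "d w y = Suc (d z y)"
proof -
  obtain p where p: "walk p" "hd p = w" "last p = y" "length p = Suc (d w y)"
    using geodesic_exists[OF adj_verts(2)[OF assms(2)] assms(1)] .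
  obtain p' where p': "walk p'" "hd p' = w'" "last p' = y" "length p' = Suc (d w' y)"
    using geodesic_exists[OF adj_verts(2)[OF assms(3)] assms(1)] .
  obtain q q' where q: "p = w # q" "p' = w' # q'" using p p' by (cases p; cases p') auto
  have w: "walk (x # w # q)" "walk (x # w' # q')" using p p' q assms by (auto simp: walk_simps)
  have "x # w # q \<simeq> x # w' # q'"
    using w p p' q assms by (intro reduced_unique shortest_reduced) auto
  from last_edges[OF this] assms(4) obtain z r where z: "sq w x w' z" "w # q \<simeq> w # z # r" by blast
  have "reduced (w # q)" using p q by (intro shortest_reduced) auto
  then have "reduced (z # r)" using reduced_cong[OF z(2)] reduced_ConsD by blast
  moreover have "walk (z # r)" using swaps_walk[OF z(2)] p q by (auto simp: walk_simps)
  ultimately have "length (z # r) = Suc (d z y)"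
    using reduced_length[of "z # r"] swaps_hd[OF z(2)] p q by simp
  moreover have "length (w # q) = Suc (length (z # r))" using swaps_length[OF z(2)] by simp
  ultimately have "d w y = Suc (d z y)" using p q by simp
  moreover have "sq x w z w'" using z(1) by (metis sq_flip sq_rot)
  ultimately show thesis using that by blast
qed

lemma dist_sym: assumes "x \<in> verts X" "y \<in> verts X" shows "d x y = d y x"
proof -
  have "d y x \<le> d x y" if xy: "x \<in> verts X" "y \<in> verts X" for x y
  proof -
    obtain p where p: "walk p" "hd p = x" "last p = y" "length p = Suc (d x y)"
      by (rule geodesic_exists[OF xy])
    then have "p \<noteq> []" by auto
    then show ?thesis using dist_le[of "rev p"] p by (simp add: walk_rev hd_rev last_rev)
  qed
  then show ?thesis using assms by (meson le_antisym)
qed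

lemma dist_0: assumes "x \<in> verts X" "y \<in> verts X" shows "d x y = 0 \<longleftrightarrow> x = y"
proof
  assume "d x y = 0"
  then obtain p where p: "walk p" "hd p = x" "last p = y" "length p = 1"
    using geodesic_exists[OF assms] by auto
  then show "x = y" by (cases p) auto
next
  assume "x = y"
  then show "d x y = 0" using dist_le[of "[x]"] assms by (simp add: walk_simps)
qed

lemma dist_triangle:
  assumes "x \<in> verts X" "y \<in> verts X" "z \<in> verts X" shows "d x z \<le> d x y + d y z"
proof -
  obtain p where p: "walk p" "hd p = x" "last p = y" "length p = Suc (d x y)"
    by (rule geodesic_exists[OF assms(1,2)])
  obtain q where q: "walk q" "hd q = y" "last q = z" "length q = Suc (d y z)"
    by (rule geodesic_exists[OF assms(2,3)])
  obtain q' where q': "q = y # q'" using q by (cases q) auto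
  have "p \<noteq> []" using p by auto
  then have "walk (p @ q')" "hd (p @ q') = x" "last (p @ q') = z"
    using p q q' by (auto simp: walk_append walk_Cons split: if_splits)
  then show ?thesis using dist_le[of "p @ q'"] p q q' by simp
qed

end

section \<open>Halfspaces and convexity in quadrangle graphs\<close>

text \<open>
  The properties of the 1-skeleton that carry the theory of halfspaces: a connected bipartite graph
  with its path metric, the quadrangle condition, and no two vertices with three common neighbours.
\<close>

locale quad_graph =
  fixes V :: "'v set" and adj :: "'v \<Rightarrow> 'v \<Rightarrow> bool" and d :: "'v \<Rightarrow> 'v \<Rightarrow> nat"
  assumes adj_V: "adj u v \<Longrightarrow> u \<in> V \<and> v \<in> V"
    and adj_sym: "adj u v \<Longrightarrow> adj v u"
    and d_0: "x \<in> V \<Longrightarrow> y \<in> V \<Longrightarrow> d x y = 0 \<longleftrightarrow> x = y"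
    and d_sym: "x \<in> V \<Longrightarrow> y \<in> V \<Longrightarrow> d x y = d y x"
    and d_tri: "x \<in> V \<Longrightarrow> y \<in> V \<Longrightarrow> z \<in> V \<Longrightarrow> d x z \<le> d x y + d y z"
    and d_step: "x \<in> V \<Longrightarrow> y \<in> V \<Longrightarrow> d x y = Suc n \<Longrightarrow> \<exists>z. adj x z \<and> d z y = n"
    and d_bip: "adj u v \<Longrightarrow> y \<in> V \<Longrightarrow> d u y = Suc (d v y) \<or> d v y = Suc (d u y)"
    and quadrangle: "y \<in> V \<Longrightarrow> adj x w \<Longrightarrow> adj x w' \<Longrightarrow> w \<noteq> w' \<Longrightarrow> d x y = Suc (d w y) \<Longrightarrow>
      d x y = Suc (d w' y) \<Longrightarrow> \<exists>z. adj w z \<and> adj w' z \<and> d w y = Suc (d z y)"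
    and no_K23: "u \<noteq> v \<Longrightarrow> x \<noteq> y \<Longrightarrow> adj u x \<Longrightarrow> adj v x \<Longrightarrow> adj u y \<Longrightarrow> adj v y \<Longrightarrow>
      adj u z \<Longrightarrow> adj v z \<Longrightarrow> z = x \<or> z = y"
begin

text \<open>
  For an edge \<open>uv\<close> this is the halfspace of its hyperplane that contains \<open>u\<close>.
\<close>

definition W :: "'v \<Rightarrow> 'v \<Rightarrow> 'v set" where
  "W u v = {x \<in> V. d u x < d v x}"

text \<open>
  Oriented edges on opposite sides of a 4-cycle, pointing the same way.
\<close>

definition para :: "'v \<times> 'v \<Rightarrow> 'v \<times> 'v \<Rightarrow> bool" where
  "para e f \<longleftrightarrow> adj (fst e) (snd e) \<and> adj (fst f) (snd f) \<and> adj (fst e) (fst f) \<and>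
     adj (snd e) (snd f) \<and> fst e \<noteq> snd f \<and> snd e \<noteq> fst f"

lemma d_self: "x \<in> V \<Longrightarrow> d x x = 0"
  using d_0 by blast

lemma adj_d: "adj u v \<Longrightarrow> d u v = 1"
  using d_bip[of u v v] d_self adj_V by fastforce

lemma W_V: "W u v \<subseteq> V"
  by (auto simp: W_def)

lemma W_compl: "adj u v \<Longrightarrow> V - W u v = W v u"
  using d_bip by (fastforce simp: W_def)

lemma W_self: "adj u v \<Longrightarrow> u \<in> W u v" "adj u v \<Longrightarrow> v \<notin> W u v"
  using adj_d d_self adj_V adj_sym by (fastforce simp: W_def)+

lemma W_iff: "adj u v \<Longrightarrow> x \<in> W u v \<longleftrightarrow> x \<in> V \<and> d v x = Suc (d u x)"
  using d_bip[of u v x] by (auto simp: W_def)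

text \<open>
  If a vertex \<open>x\<close> were closer to \<open>u\<close> than to \<open>v\<close>, but closer to \<open>v'\<close> than to \<open>u'\<close>, then
  \<open>v\<close> and \<open>u'\<close> would be common neighbours of \<open>u\<close> and \<open>v'\<close> that are farther from \<open>x\<close>, and the
  quadrangle condition at \<open>v\<close> would supply a third common neighbour.
\<close>

lemma W_para_subset: assumes "para (u, v) (u', v')" shows "W u v \<subseteq> W u' v'"
proof
  fix x assume x: "x \<in> W u v"
  have a: "adj u v" "adj u' v'" "adj u u'" "adj v v'" "u \<noteq> v'" "v \<noteq> u'"
    using assms by (auto simp: para_def)
  have xV: "x \<in> V" and dv: "d v x = Suc (d u x)" using x a by (auto simp: W_iff)
  show "x \<in> W u' v'"
  proof (rule ccontr)
    assume "x \<notin> W u' v'"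
    then have 1: "d u' x = Suc (d v' x)" using W_iff[OF a(2)] d_bip[OF a(2) xV] xV by blast
    then have 2: "d v' x = d u x" "d u' x = Suc (d u x)"
      using d_bip[OF a(3) xV] d_bip[OF a(4) xV] dv by arith+
    have "d v x = Suc (d v' x)" using dv 2 by simp
    then obtain z where z: "adj u z" "adj v' z" "d u x = Suc (d z x)"
      using quadrangle[OF xV adj_sym[OF a(1)] a(4,5) dv] by blast
    then have "z = v \<or> z = u'" using no_K23[of u v' v u' z] a adj_sym by blast
    then show False
    proof
      assume "z = v" then show False using z(3) dv by arith
    next
      assume "z = u'" then show False using z(3) 2(2) by arith
    qed
  qed
qed

lemma para_sym: "para e f \<Longrightarrow> para f e"
  using adj_sym by (auto simp: para_def)

lemma para_flip: "para (u, v) (u', v') \<Longrightarrow> para (v, u) (v', u')"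
  using adj_sym by (auto simp: para_def)

lemma W_para: "para\<^sup>*\<^sup>* (u, v) (u', v') \<Longrightarrow> W u v = W u' v'"
proof (induction rule: rtranclp_induct2)
  case (step a b a' b')
  then show ?case using W_para_subset para_sym by blast
qed simp

text \<open>
  An edge that leads from one side of \<open>uv\<close> to the other is parallel to \<open>uv\<close>: a first step from \<open>u\<close>
  towards \<open>x\<close> and the quadrangle condition for \<open>y\<close> slide \<open>uv\<close> across a 4-cycle closer to \<open>xy\<close>.
\<close>

lemma crossing_para:
  assumes "adj u v" "adj x y" "x \<in> W u v" "y \<in> W v u"
  shows "para\<^sup>*\<^sup>* (u, v) (x, y)"
  using assms
proof (induction "d u x" arbitrary: u v)
  case 0
  have V: "u \<in> V" "v \<in> V" "x \<in> V" "y \<in> V" using 0 adj_V by auto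
  then have "u = x" using 0(1) d_0 by auto
  then have "d u y = 1" using 0 adj_d by auto
  then have "d v y = 0" using 0 adj_sym by (simp add: W_iff)
  then show ?case using \<open>u = x\<close> V d_0 by auto
next
  case (Suc n)
  have V: "u \<in> V" "v \<in> V" "x \<in> V" "y \<in> V" using Suc adj_V by auto
  have dx: "d v x = Suc (Suc n)" "d u x = Suc n" using Suc(2,5) W_iff[OF Suc(3)] by simp_all
  have dy: "d u y = Suc (d v y)" using Suc(6) W_iff[OF adj_sym[OF Suc(3)]] by simp
  have "d x u = Suc (d y u) \<or> d y u = Suc (d x u)" "d x v = Suc (d y v) \<or> d y v = Suc (d x v)"
    using d_bip[OF Suc(4)] V by blast+
  moreover have "d x u = d u x" "d x v = d v x" "d y u = d u y" "d y v = d v y"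
    using d_sym V by blast+
  ultimately have dy': "d v y = Suc n" "d u y = Suc (Suc n)" using dx dy by arith+
  obtain u1 where u1: "adj u u1" "d u1 x = n" using d_step[OF V(1,3) dx(2)] by blast
  have u1V: "u1 \<in> V" using u1 adj_V by auto
  have "d u1 y \<le> Suc n" using d_tri[OF u1V V(3,4)] adj_d[OF Suc(4)] u1 by simp
  then have u1y: "d u1 y = Suc n" using d_bip[OF u1(1) V(4)] dy' by arith
  have "u1 \<noteq> v" using u1 dx by auto
  moreover have "d u y = Suc (d v y)" "d u y = Suc (d u1 y)" using dy' u1y by simp_all
  ultimately obtain v1 where v1: "adj v v1" "adj u1 v1" "d v y = Suc (d v1 y)"
    using quadrangle[OF V(4) Suc(3) u1(1)] by blast
  have p: "para (u, v) (u1, v1)" using Suc(3) u1 v1 \<open>u1 \<noteq> v\<close> dy' by (auto simp: para_def)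
  have "W u v = W u1 v1" "W v u = W v1 u1"
    using W_para[of u v u1 v1] W_para[of v u v1 u1] p para_flip by blast+
  then have "para\<^sup>*\<^sup>* (u1, v1) (x, y)"
    using Suc.hyps(1)[of u1 v1] u1(2) v1(2) Suc.prems by simp
  then show ?case using p by (rule converse_rtranclp_into_rtranclp[rotated])
qed

lemma crossing_W:
  assumes "adj u v" "adj x y" "x \<in> W u v" "y \<notin> W u v" shows "W x y = W u v"
proof -
  have "y \<in> W v u" using assms(4) adj_V[OF assms(2)] W_compl[OF assms(1), symmetric] by simp
  then have "para\<^sup>*\<^sup>* (u, v) (x, y)" using crossing_para assms by blast
  then show ?thesis by (rule W_para[symmetric])
qed

definition convex :: "'v set \<Rightarrow> bool" where
  "convex D \<longleftrightarrow> D \<subseteq> V \<and> (\<forall>x\<in>D. \<forall>y\<in>D. \<forall>z\<in>V. d x z + d z y = d x y \<longrightarrow> z \<in> D)"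

lemma convexD: "convex D \<Longrightarrow> x \<in> D \<Longrightarrow> y \<in> D \<Longrightarrow> z \<in> V \<Longrightarrow> d x z + d z y = d x y \<Longrightarrow> z \<in> D"
  unfolding convex_def by blast

lemma convex_Int: "convex A \<Longrightarrow> convex B \<Longrightarrow> convex (A \<inter> B)"
  unfolding convex_def by blast

lemma crossing_edge:
  assumes "x \<in> V" "y \<in> V" "x \<in> A" "y \<notin> A"
  shows "\<exists>a b. adj a b \<and> a \<in> A \<and> b \<notin> A \<and> d x y = d x a + 1 + d b y"
  using assms
proof (induction "d x y" arbitrary: x)
  case 0 then show ?case using d_0 by metis
next
  case (Suc n)
  obtain z where z: "adj x z" "d z y = n" using d_step[OF Suc(3,4) Suc(2)[symmetric]] by blast
  have zV: "z \<in> V" using z adj_V by auto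
  show ?case
  proof (cases "z \<in> A")
    case False
    then show ?thesis using z Suc.prems Suc.hyps(2)[symmetric] d_self[of x] by (intro exI[of _ x] exI[of _ z]) simp
  next
    case True
    then obtain a b where ab: "adj a b" "a \<in> A" "b \<notin> A" "d z y = d z a + 1 + d b y"
      using Suc.hyps(1)[of z] z zV Suc.prems by blast
    have V: "a \<in> V" "b \<in> V" using ab adj_V by auto
    have "d x a \<le> 1 + d z a" using d_tri[of x z a] adj_d[OF z(1)] V zV Suc.prems by simp
    moreover have "d x y \<le> d x a + (1 + d b y)"
      using d_tri[of x a y] d_tri[of a b y] adj_d[OF ab(1)] V Suc.prems by simp
    ultimately have "d x y = d x a + 1 + d b y" using ab z Suc.hyps(2) by simp
    then show ?thesis using ab by blast
  qed
qed

text \<open>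
  A geodesic leaving \<open>W u v\<close> does so through an edge with the same halfspaces as \<open>uv\<close>. It moves away
  from every vertex of \<open>W u v\<close> there and so cannot return.
\<close>

lemma convex_W: assumes "adj u v" shows "convex (W u v)"
  unfolding convex_def
proof (intro conjI ballI impI)
  show "W u v \<subseteq> V" by (rule W_V)
  fix x y z assume x: "x \<in> W u v" and y: "y \<in> W u v" and z: "z \<in> V" and b: "d x z + d z y = d x y"
  show "z \<in> W u v"
  proof (rule ccontr)
    assume nz: "z \<notin> W u v"
    have V: "x \<in> V" "y \<in> V" using x y W_V by auto
    obtain a c where ac: "adj a c" "a \<in> W u v" "c \<notin> W u v" "d x z = d x a + 1 + d c z"
      using crossing_edge[OF V(1) z x nz] by blast
    have "W a c = W u v" by (rule crossing_W[OF assms ac(1-3)])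
    then have "d c y = Suc (d a y)" using y W_iff[OF ac(1)] by simp
    moreover have "d x y \<le> d x a + d a y" "d c y \<le> d c z + d z y"
      using d_tri V z adj_V[OF ac(1)] by blast+
    ultimately show False using b ac by simp
  qed
qed

text \<open>
  A nearest point is a gate. Along a geodesic in \<open>D\<close> starting at the nearest point \<open>w\<close>, let \<open>y\<close> be the
  first vertex at which the distance to \<open>v\<close> drops. The quadrangle condition at its predecessor gives a
  vertex \<open>z\<close> that is still in \<open>D\<close> by convexity and violates the claim at a smaller distance from \<open>w\<close>.
\<close>

lemma gate:
  assumes D: "convex D" "D \<noteq> {}" and v: "v \<in> V"
  obtains w where "w \<in> D" "\<And>y. y \<in> D \<Longrightarrow> d v y = d v w + d w y"
proof -
  obtain w where w: "w \<in> D" "\<And>y. y \<in> D \<Longrightarrow> d v w \<le> d v y"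
    using ex_has_least_nat[of "\<lambda>y. y \<in> D" _ "d v"] D by blast
  have DV: "D \<subseteq> V" using D by (simp add: convex_def)
  have "d v y = d v w + d w y" if "y \<in> D" for y
    using that
  proof (induction "d w y" arbitrary: y rule: less_induct)
    case less
    have V: "w \<in> V" "y \<in> V" using w less DV by auto
    show ?case
    proof (cases "d w y")
      case 0 then show ?thesis using V d_0 by auto
    next
      case (Suc n)
      then obtain y1 where y1: "adj y y1" "d y1 w = n" using d_step[of y w n] V d_sym by metis
      have y1V: "y1 \<in> V" using y1 adj_V by auto
      have y1': "d w y1 = n" "d y1 y = 1"
        using y1 V y1V d_sym[of w y1] adj_d[OF adj_sym[OF y1(1)]] by simp_all
      have y1D: "y1 \<in> D" using convexD[OF D(1) w(1) less.prems y1V] y1' Suc by simp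
      have dy1: "d v y1 = d v w + n" using less.hyps[of y1] y1' y1D Suc by simp
      show ?thesis
      proof (rule ccontr)
        assume ne: "d v y \<noteq> d v w + d w y"
        have bip: "d y v = Suc (d y1 v) \<or> d y1 v = Suc (d y v)" using d_bip[OF y1(1) v] .
        have s: "d y v = d v y" "d y1 v = d v y1" using d_sym v V y1V by blast+
        have dy: "d v w + n = Suc (d v y)" using ne bip s dy1 Suc by arith
        show False
        proof (cases n)
          case 0 then show False using dy w(2)[OF less.prems] by simp
        next
          case (Suc m)
          then obtain y2 where y2: "adj y1 y2" "d y2 w = m" using d_step[of y1 w m] y1 V y1V by metis
          have y2V: "y2 \<in> V" using y2 adj_V by auto
          have y2': "d w y2 = m" "d y2 y1 = 1"
            using y2 V y2V d_sym[of w y2] adj_d[OF adj_sym[OF y2(1)]] by simp_all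
          have y2D: "y2 \<in> D" using convexD[OF D(1) w(1) y1D y2V] y2' y1' Suc by simp
          have dy2: "d v y2 = d v w + m"
            using less.hyps[of y2] y2' y2D \<open>d w y = Suc n\<close> Suc by simp
          have ne2: "y2 \<noteq> y" using y2' \<open>d w y = Suc n\<close> Suc by auto
          have s2: "d y2 v = d v y2" using d_sym v y2V by auto
          have "d y1 v = Suc (d y2 v)" "d y1 v = Suc (d y v)" using s s2 dy dy1 dy2 Suc by arith+
          then obtain z where z: "adj y2 z" "adj y z" "d y2 v = Suc (d z v)"
            using quadrangle[OF v y2(1) adj_sym[OF y1(1)] ne2] by blast
          have zV: "z \<in> V" using z adj_V by auto
          have "d y2 y = 2"
            using d_bip[OF y2(1) V(2)] y1'(2) d_0[OF y2V V(2)] ne2 by arith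
          then have zD: "z \<in> D"
            using convexD[OF D(1) y2D less.prems zV] adj_d[OF z(1)] adj_d[OF adj_sym[OF z(2)]] by simp
          have sz: "d w z = d z w" "d w y = d y w" using d_sym V zV by blast+
          have "d z w \<le> Suc m" using d_tri[of z y2 w] adj_d[OF adj_sym[OF z(1)]] zV y2V V y2 by simp
          then have dz: "d w z = Suc m"
            using d_bip[OF z(2) V(1)] sz \<open>d w y = Suc n\<close> Suc by arith
          have "d v z = d v w + Suc m"
            using less.hyps[of z] dz zD \<open>d w y = Suc n\<close> Suc by simp
          moreover have "d v z = d z v" using d_sym v zV by blast
          ultimately show False using z(3) s2 dy2 by simp
        qed
      qed
    qed
  qed
  then show thesis using that w by blast
qed

text \<open>
  The first edge on the way to the gate separates \<open>v\<close> from all of \<open>D\<close>.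
\<close>

lemma gate_edge:
  assumes D: "convex D" "D \<noteq> {}" and v: "v \<in> V" "v \<notin> D"
  obtains a where "adj v a" "D \<subseteq> W a v"
proof -
  obtain w where w: "w \<in> D" "\<And>y. y \<in> D \<Longrightarrow> d v y = d v w + d w y" using gate[OF D v(1)] by blast
  have DV: "D \<subseteq> V" using D by (simp add: convex_def)
  have "w \<in> V" "v \<noteq> w" using v w DV by auto
  then have "d v w \<noteq> 0" using v(1) d_0 by blast
  then obtain n where n: "d v w = Suc n" by (cases "d v w") auto
  then obtain a where a: "adj v a" "d a w = n" using d_step[OF v(1) \<open>w \<in> V\<close>] by blast
  have "D \<subseteq> W a v"
  proof
    fix y assume y: "y \<in> D"
    then have "y \<in> V" using DV by auto
    then have "d a y \<le> d a w + d w y" using d_tri[of a w y] adj_V[OF a(1)] \<open>w \<in> V\<close> by simp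
    then have "d a y < d v y" using w(2)[OF y] n a by simp
    then show "y \<in> W a v" using \<open>y \<in> V\<close> by (simp add: W_def)
  qed
  then show thesis using that a by blast
qed

text \<open>
  The gate in \<open>C\<close> of a point of \<open>A \<inter> B\<close> lies on geodesics to points of \<open>A \<inter> C\<close> and of \<open>B \<inter> C\<close>.
\<close>

lemma helly3:
  assumes "convex A" "convex B" "convex C" "A \<inter> B \<noteq> {}" "B \<inter> C \<noteq> {}" "A \<inter> C \<noteq> {}"
  shows "A \<inter> B \<inter> C \<noteq> {}"
proof -
  obtain x where x: "x \<in> A" "x \<in> B" using assms by auto
  have V: "x \<in> V" "C \<subseteq> V" using x assms unfolding convex_def by blast+
  obtain g where g: "g \<in> C" "\<And>y. y \<in> C \<Longrightarrow> d x y = d x g + d g y"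
    using gate[OF assms(3) _ V(1)] assms by blast
  have "g \<in> D" if D: "convex D" "x \<in> D" "D \<inter> C \<noteq> {}" for D
  proof -
    obtain y where "y \<in> D" "y \<in> C" using D(3) by blast
    then show ?thesis using convexD[OF D(1,2), of y g] g V by (metis subsetD)
  qed
  then have "g \<in> A" "g \<in> B" using assms x by auto
  then show ?thesis using g by auto
qed

lemma helly:
  assumes "finite F" "\<And>B. B \<in> F \<Longrightarrow> convex B" "\<And>B C. B \<in> F \<Longrightarrow> C \<in> F \<Longrightarrow> B \<inter> C \<noteq> {}"
    "convex A" "A \<noteq> {}" "\<And>B. B \<in> F \<Longrightarrow> A \<inter> B \<noteq> {}"
  shows "A \<inter> \<Inter>F \<noteq> {}"
  using assms
proof (induction F arbitrary: A rule: finite_induct)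
  case (insert B F)
  note conv = insert.prems(1) and meet = insert.prems(2) and A = insert.prems(3-5)
  have "(A \<inter> B) \<inter> \<Inter>F \<noteq> {}"
  proof (rule insert.IH)
    show "convex (A \<inter> B)" using A(1) conv by (simp add: convex_Int)
    show "A \<inter> B \<noteq> {}" using A(3) by simp
    fix C assume C: "C \<in> F"
    show "convex C" using conv C by simp
    show "(A \<inter> B) \<inter> C \<noteq> {}"
      by (rule helly3[OF A(1) conv conv A(3) meet A(3)]) (simp_all add: C)
    fix D assume "D \<in> F"
    then show "C \<inter> D \<noteq> {}" using meet C by simp
  qed
  then show ?case by (simp add: Int_assoc)
next
  case empty
  then show ?case by simp
qed

lemma convex_Inter: "(\<And>B. B \<in> F \<Longrightarrow> convex B) \<Longrightarrow> F \<noteq> {} \<Longrightarrow> convex (\<Inter>F)"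
  unfolding convex_def[of "\<Inter>F"]
proof (intro conjI ballI impI InterI)
  assume F: "\<And>B. B \<in> F \<Longrightarrow> convex B" "F \<noteq> {}"
  then show "\<Inter>F \<subseteq> V" by (meson Inter_lower convex_def ex_in_conv order_trans)
  fix x y z B assume "x \<in> \<Inter>F" "y \<in> \<Inter>F" "z \<in> V" "d x z + d z y = d x y" "B \<in> F"
  then show "z \<in> B" using convexD[OF F(1), of B x y z] by simp
qed

text \<open>
  Halfspaces are represented by their vertex sets; the opposite of \<open>h\<close> is \<open>V - h\<close>.
\<close>

definition HS :: "'v set set" where
  "HS = {W u v |u v. adj u v}"

lemma HS_W: "adj u v \<Longrightarrow> W u v \<in> HS"
  by (auto simp: HS_def)

lemma HS_opp: "h \<in> HS \<Longrightarrow> V - h \<in> HS"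
  using W_compl adj_sym by (force simp: HS_def)

lemma HS_convex: "h \<in> HS \<Longrightarrow> convex h"
  by (auto simp: HS_def convex_W)

lemma HS_V: "h \<in> HS \<Longrightarrow> h \<subseteq> V"
  using W_V by (auto simp: HS_def)

lemma HS_ne: "h \<in> HS \<Longrightarrow> h \<noteq> {}"
  using W_self(1) unfolding HS_def by blast

lemma opp_opp: "h \<in> HS \<Longrightarrow> V - (V - h) = h"
  using HS_V by blast

lemma HS_cross: assumes "h \<in> HS" "adj x y" "x \<in> h" "y \<notin> h" shows "W x y = h"
proof -
  obtain u v where "adj u v" "h = W u v" using assms(1) by (auto simp: HS_def)
  then show ?thesis using crossing_W[of u v x y] assms by simp
qed

lemma HS_enter:
  assumes "h \<in> HS" "adj v w" "v \<in> h" "W w v \<inter> h = {}" shows "W w v = V - h"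
proof -
  have "w \<notin> h" using W_self(1)[OF adj_sym[OF assms(2)]] assms(4) by blast
  then have "W v w = h" by (rule HS_cross[OF assms(1-3)])
  then show ?thesis using W_compl[OF assms(2)] by simp
qed

lemma HS_between:
  assumes "h \<in> HS" "x \<notin> h" "y \<notin> h" "x \<in> V" "y \<in> V" "z \<in> V" "d x z + d z y = d x y"
  shows "z \<notin> h"
  using convexD[OF HS_convex[OF HS_opp[OF assms(1)]], of x y z] assms by blast

text \<open>
  A halfspace that separates a point from its gate separates it from the whole convex set.
\<close>

lemma gate_sep:
  assumes "x \<in> V" "D \<subseteq> V" "w \<in> D" "\<And>y. y \<in> D \<Longrightarrow> d x y = d x w + d w y" "j \<in> HS" "x \<notin> j" "w \<in> j"
  shows "D \<subseteq> j"
proof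
  fix y assume y: "y \<in> D"
  show "y \<in> j" using HS_between[OF assms(5,6), of y w] y assms(1-4,7) by (metis subsetD)
qed

definition transv :: "'v set \<Rightarrow> 'v set \<Rightarrow> bool" where
  "transv h k \<longleftrightarrow> h \<inter> k \<noteq> {} \<and> h \<inter> (V - k) \<noteq> {} \<and> (V - h) \<inter> k \<noteq> {} \<and> (V - h) \<inter> (V - k) \<noteq> {}"

lemma transv_sym: "transv h k \<Longrightarrow> transv k h"
  by (auto simp: transv_def)

lemma transv_irrefl: "\<not> transv h h"
  by (auto simp: transv_def)

lemma transv_opp: "h \<in> HS \<Longrightarrow> transv h k \<Longrightarrow> transv (V - h) k"
  by (simp add: transv_def opp_opp)

text \<open>
  Start at a point outside all members of \<open>K\<close> and let \<open>v\<close> be its gate in the intersection. The first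
  edge from \<open>v\<close> towards the complement of \<open>k\<close> bounds a halfspace \<open>j \<subseteq> k\<close> that contains the
  intersection of \<open>K\<close>. By the Helly property \<open>j\<close> contains some member of \<open>K\<close>, and transversality
  leaves only \<open>j = k\<close>.
\<close>

lemma transverse_family_at_vertex:
  assumes fin: "finite K" and K: "K \<subseteq> HS" "K \<noteq> {}" and tr: "\<And>h k. h \<in> K \<Longrightarrow> k \<in> K \<Longrightarrow> h \<noteq> k \<Longrightarrow> transv h k"
  shows "\<exists>p\<in>V. \<forall>k\<in>K. p \<notin> k"
    and "\<exists>v f. v \<in> \<Inter>K \<and> inj_on f K \<and> f ` K \<subseteq> {a. adj v a}"
proof -
  obtain k0 where k0: "k0 \<in> K" using K by auto
  have "(V - k0) \<inter> \<Inter>((\<lambda>k. V - k) ` K) \<noteq> {}"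
  proof (rule helly)
    have meet: "(V - h) \<inter> (V - k) \<noteq> {}" if "h \<in> K" "k \<in> K" for h k
      using tr[of h k] that K HS_ne[OF HS_opp] by (cases "h = k") (auto simp: transv_def)
    fix B assume B: "B \<in> (\<lambda>k. V - k) ` K"
    then show "convex B" using K by (auto intro: HS_convex HS_opp)
    show "(V - k0) \<inter> B \<noteq> {}" using meet B k0 by blast
    fix C assume C: "C \<in> (\<lambda>k. V - k) ` K"
    then show "B \<inter> C \<noteq> {}" using meet B by blast
  qed (use fin k0 K in \<open>auto intro!: HS_convex HS_opp dest: HS_ne[OF HS_opp]\<close>)
  then obtain x where x: "x \<in> V" "\<And>k. k \<in> K \<Longrightarrow> x \<notin> k" by blast
  have meetK: "h \<inter> k \<noteq> {}" if "h \<in> K" "k \<in> K" for h k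
    using tr[of h k] that K HS_ne by (cases "h = k") (auto simp: transv_def)
  have conv: "convex (\<Inter>K)" using K HS_convex by (intro convex_Inter) auto
  have "k0 \<inter> \<Inter>K \<noteq> {}" by (rule helly) (use fin K k0 meetK HS_convex HS_ne in auto)
  then have ne: "\<Inter>K \<noteq> {}" by auto
  obtain v where v: "v \<in> \<Inter>K" "\<And>y. y \<in> \<Inter>K \<Longrightarrow> d x y = d x v + d v y"
    using gate[OF conv ne x(1)] by blast
  have vV: "v \<in> V" using v(1) k0 K HS_V by blast
  have sub: "\<Inter>K \<subseteq> V" using k0 K HS_V by blast
  have "\<exists>a. adj v a \<and> W v a = k" if k: "k \<in> K" for k
  proof -
    have kH: "k \<in> HS" "V - k \<in> HS" using k K HS_opp by auto
    obtain a where a: "adj v a" "V - k \<subseteq> W a v"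
      using gate_edge[OF HS_convex[OF kH(2)] HS_ne[OF kH(2)] vV] v k by blast
    let ?j = "W v a"
    have jk: "?j \<subseteq> k" using a W_compl[of v a] W_V by blast
    have xj: "x \<notin> ?j" using x(2)[OF k] jk by auto
    have j: "\<Inter>K \<subseteq> ?j" using gate_sep[OF x(1) sub v HS_W[OF a(1)] xj W_self(1)[OF a(1)]] by blast
    have "\<exists>k'\<in>K. (V - ?j) \<inter> k' = {}"
    proof (rule ccontr)
      assume "\<not> ?thesis"
      then have "(V - ?j) \<inter> \<Inter>K \<noteq> {}"
        using fin K meetK HS_convex HS_opp[OF HS_W[OF a(1)]] HS_ne by (intro helly) auto
      then show False using j by auto
    qed
    then obtain k' where k': "k' \<in> K" "k' \<subseteq> ?j" using K HS_V by blast
    then have "k' = k" using tr[OF k'(1) k] jk by (auto simp: transv_def)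
    then show ?thesis using k' jk a by auto
  qed
  then obtain f where f: "\<And>k. k \<in> K \<Longrightarrow> adj v (f k) \<and> W v (f k) = k" by metis
  then have "inj_on f K" by (metis inj_onI)
  moreover have "f ` K \<subseteq> {a. adj v a}" using f by auto
  ultimately show "\<exists>v f. v \<in> \<Inter>K \<and> inj_on f K \<and> f ` K \<subseteq> {a. adj v a}" using v(1) by metis
  show "\<exists>p\<in>V. \<forall>k\<in>K. p \<notin> k" using x by auto
qed

end

section \<open>Ultrafilters and digging\<close>

text \<open>
  The far side of the second edge is a halfspace properly inside the near side of the first, so every
  halfspace can be dug into from its boundary. This is the form in which straight links are used. The
  bound \<open>N\<close> limits the size of transverse families.
\<close>

locale straight_graph = quad_graph V adj d
  for V :: "'v set" and adj :: "'v \<Rightarrow> 'v \<Rightarrow> bool" and d :: "'v \<Rightarrow> 'v \<Rightarrow> nat" +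
  fixes N :: nat
  assumes straight: "adj v a \<Longrightarrow> \<exists>b. adj v b \<and> W b v \<inter> W a v = {}"
    and valence: "v \<in> V \<Longrightarrow> finite {a. adj v a} \<and> card {a. adj v a} \<le> N"
begin

lemma countable_HS: "countable HS"
proof -
  have "countable V"
  proof (cases "V = {}")
    case False
    then obtain p where p: "p \<in> V" by auto
    have fin: "finite {v \<in> V. d v p = n}" for n
    proof (induction n)
      case 0
      have "{v \<in> V. d v p = 0} \<subseteq> {p}" using d_0 p by auto
      then show ?case using finite_subset by blast
    next
      case (Suc n)
      have "{v \<in> V. d v p = Suc n} \<subseteq> (\<Union>z\<in>{v \<in> V. d v p = n}. {a. adj z a})"
      proof
        fix v assume "v \<in> {v \<in> V. d v p = Suc n}"
        then obtain z where "adj v z" "d z p = n" using d_step[of v p n] p by auto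
        then show "v \<in> (\<Union>z\<in>{v \<in> V. d v p = n}. {a. adj z a})" using adj_V[of v z] adj_sym[of v z] by auto
      qed
      moreover have "finite (\<Union>z\<in>{v \<in> V. d v p = n}. {a. adj z a})" using Suc valence by auto
      ultimately show ?case by (rule finite_subset)
    qed
    have "V \<subseteq> (\<Union>n. {v \<in> V. d v p = n})" by auto
    moreover have "countable (\<Union>n. {v \<in> V. d v p = n})" using fin by (intro countable_UN countableI_type countable_finite)
    ultimately show ?thesis by (rule countable_subset)
  qed simp
  then have "countable ((\<lambda>(u, v). W u v) ` (V \<times> V))" by (intro countable_image countable_SIGMA) auto
  moreover have "HS \<subseteq> (\<lambda>(u, v). W u v) ` (V \<times> V)" using adj_V by (fastforce simp: HS_def)
  ultimately show ?thesis by (rule countable_subset[rotated])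
qed

definition uf :: "'v set set \<Rightarrow> bool" where
  "uf \<alpha> \<longleftrightarrow> \<alpha> \<subseteq> HS \<and> (\<forall>h\<in>HS. (h \<in> \<alpha>) \<noteq> (V - h \<in> \<alpha>)) \<and> (\<forall>h\<in>\<alpha>. \<forall>k\<in>HS. h \<subseteq> k \<longrightarrow> k \<in> \<alpha>)"

lemma uf_HS: "uf \<alpha> \<Longrightarrow> h \<in> \<alpha> \<Longrightarrow> h \<in> HS"
  unfolding uf_def by (elim conjE) (rule subsetD)

lemma uf_up: "uf \<alpha> \<Longrightarrow> h \<in> \<alpha> \<Longrightarrow> k \<in> HS \<Longrightarrow> h \<subseteq> k \<Longrightarrow> k \<in> \<alpha>"
  unfolding uf_def by (elim conjE) simp

lemma uf_opp: "uf \<alpha> \<Longrightarrow> h \<in> HS \<Longrightarrow> V - h \<in> \<alpha> \<longleftrightarrow> h \<notin> \<alpha>"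
  unfolding uf_def by (elim conjE, drule (1) bspec[of HS]) simp

lemma uf_meet: assumes "uf \<alpha>" "h \<in> \<alpha>" "k \<in> \<alpha>" shows "h \<inter> k \<noteq> {}"
proof
  assume "h \<inter> k = {}"
  then have "h \<subseteq> V - k" using HS_V uf_HS[OF assms(1,2)] by blast
  then have "V - k \<in> \<alpha>" using uf_up[OF assms(1,2)] HS_opp uf_HS[OF assms(1,3)] by blast
  then show False using uf_opp[OF assms(1)] uf_HS[OF assms(1,3)] assms(3) by blast
qed

text \<open>
  If no halfspace properly inside \<open>h\<close> contains \<open>v\<close>, then \<open>h\<close> is bounded by an edge at \<open>v\<close>, and
  straightness provides an edge at \<open>v\<close> that leads properly into \<open>h\<close>. Crossing it leads away from \<open>p\<close>,
  because \<open>p\<close> is not in \<open>h\<close>.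
\<close>

lemma dig_inside:
  assumes p: "p \<in> V" and v: "v \<in> h" and h: "h \<in> HS" and ph: "p \<notin> h"
  obtains v' k where "v' \<in> V" "d p v' = d p v + d v v'" "k \<in> HS" "p \<notin> k" "v' \<in> k" "k \<subset> h"
proof (cases "\<exists>k\<in>HS. v \<in> k \<and> k \<subset> h")
  case True
  then obtain k where "k \<in> HS" "v \<in> k" "k \<subset> h" by blast
  moreover have "v \<in> V" using v h HS_V by blast
  moreover have "d p v = d p v + d v v" using \<open>v \<in> V\<close> d_self by simp
  moreover have "p \<notin> k" using ph \<open>k \<subset> h\<close> by blast
  ultimately show thesis by (intro that[of v k])
next
  case False
  have vV: "v \<in> V" using v h HS_V by blast
  note ho = HS_opp[OF h]
  obtain a where a: "adj v a" "V - h \<subseteq> W a v"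
    using gate_edge[OF HS_convex[OF ho] HS_ne[OF ho] vV] v by blast
  obtain b where b: "adj v b" "W b v \<inter> W a v = {}" using straight[OF a(1)] by blast
  have sub: "W b v \<subseteq> h" using a b W_V[of b v] by blast
  have nv: "v \<notin> W b v" using W_self(2)[OF adj_sym[OF b(1)]] .
  have np: "p \<notin> W b v" using sub ph by blast
  then have "p \<in> W v b" using p W_compl[OF adj_sym[OF b(1)]] by blast
  then have "d b p = Suc (d v p)" using W_iff[OF b(1)] by simp
  then have "d p b = d p v + d v b"
    using d_sym[of b p] d_sym[of v p] p vV adj_V[OF b(1)] adj_d[OF b(1)] by simp
  then show thesis
    using that[of b "W b v"] adj_V[OF b(1)] HS_W[OF adj_sym[OF b(1)]] W_self(1)[OF adj_sym[OF b(1)]] sub nv v np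
    by blast
qed

text \<open>
  While \<open>p\<close> and \<open>v\<close> are on the same side of \<open>h\<close>, walk towards the other side. Each step either
  leads away from \<open>p\<close>, or its hyperplane bounds a halfspace that is properly inside \<open>h\<close> and already
  separates \<open>v\<close> from \<open>p\<close>. Once the other side is reached, dig there.
\<close>

lemma dig_outside:
  assumes p: "p \<in> h" and h: "h \<in> HS" and v: "v \<in> h" and w: "w \<in> V - h"
  shows "\<exists>v' k. v' \<in> V \<and> d p v' = d p v + d v v' \<and> k \<in> HS \<and> p \<notin> k \<and> v' \<in> k \<and> (k \<subset> h \<or> k \<subset> V - h)"
  using v
proof (induction "d v w" arbitrary: v rule: less_induct)
  case less
  have V: "v \<in> V" "p \<in> V" "w \<in> V" using less.prems p h w HS_V by blast+
  note ho = HS_opp[OF h]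
  obtain a where a: "adj v a" "V - h \<subseteq> W a v"
    using gate_edge[OF HS_convex[OF ho] HS_ne[OF ho] V(1)] less.prems by blast
  have aV: "a \<in> V" using adj_V[OF a(1)] by simp
  show ?case
  proof (cases "p \<in> W a v")
    case True
    let ?k = "W v a"
    have "?k \<subseteq> h" using a W_compl[OF adj_sym[OF a(1)]] HS_V[OF h] W_V[of v a] by blast
    moreover have "p \<notin> ?k" using True W_compl[OF a(1)] by blast
    ultimately have "?k \<subset> h" "p \<notin> ?k" using p by blast+
    then show ?thesis using V HS_W[OF a(1)] W_self(1)[OF a(1)] d_self
      by (intro exI[of _ v] exI[of _ ?k]) simp
  next
    case False
    then have "p \<in> W v a" using W_compl[OF adj_sym[OF a(1)]] V by blast
    then have da: "d p a = Suc (d p v)" using W_iff[OF a(1), of p] d_sym[OF V(2,1)] d_sym[OF V(2) aV] by simp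
    have "w \<in> W a v" using a w by blast
    then have daw: "d a w < d v w" by (simp add: W_def)
    have "\<exists>v' k. v' \<in> V \<and> d p v' = d p a + d a v' \<and> k \<in> HS \<and> p \<notin> k \<and> v' \<in> k \<and> (k \<subset> h \<or> k \<subset> V - h)"
    proof (cases "a \<in> h")
      case True
      then show ?thesis using less.hyps[OF daw] by blast
    next
      case False
      obtain v' k where "v' \<in> V" "d p v' = d p a + d a v'" "k \<in> HS" "p \<notin> k" "v' \<in> k" "k \<subset> V - h"
        by (rule dig_inside[OF V(2) _ ho, of a]) (use False aV p in auto)
      then show ?thesis by blast
    qed
    then obtain v' k where k: "v' \<in> V" "d p v' = d p a + d a v'" "k \<in> HS" "p \<notin> k" "v' \<in> k"
      "k \<subset> h \<or> k \<subset> V - h" by blast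
    have "d p v' \<le> d p v + d v v'" "d v v' \<le> d v a + d a v'" using d_tri V aV k(1) by blast+
    then have "d p v' = d p v + d v v'" using k(2) da adj_d[OF a(1)] by simp
    then show ?thesis using k by blast
  qed
qed

text \<open>
  Without returning towards \<open>p\<close>, one can reach a vertex that a halfspace properly inside \<open>h\<close> or
  properly inside its complement separates from \<open>p\<close>. Halfspaces not containing \<open>p\<close> are never left
  again by walks that move away from \<open>p\<close>.
\<close>

lemma dig_at:
  assumes p: "p \<in> V" and v: "v \<in> V" and h: "h \<in> HS"
  shows "\<exists>v' k. v' \<in> V \<and> d p v' = d p v + d v v' \<and> k \<in> HS \<and> p \<notin> k \<and> v' \<in> k \<and> (k \<subset> h \<or> k \<subset> V - h)"
proof -
  have *: "\<exists>v' k. v' \<in> V \<and> d p v' = d p v + d v v' \<and> k \<in> HS \<and> p \<notin> k \<and> v' \<in> k \<and> (k \<subset> g \<or> k \<subset> V - g)"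
    if g: "g \<in> HS" and pg: "p \<in> g" for g
  proof (cases "v \<in> g")
    case True
    obtain w where "w \<in> V - g" using HS_ne[OF HS_opp[OF g]] by blast
    then show ?thesis by (rule dig_outside[OF pg g True])
  next
    case False
    then have "v \<in> V - g" "p \<notin> V - g" using v pg by auto
    then obtain v' k where "v' \<in> V" "d p v' = d p v + d v v'" "k \<in> HS" "p \<notin> k" "v' \<in> k" "k \<subset> V - g"
      using dig_inside[OF p _ HS_opp[OF g]] by blast
    then show ?thesis by blast
  qed
  show ?thesis
  proof (cases "p \<in> h")
    case True then show ?thesis by (rule *[OF h])
  next
    case False
    then show ?thesis using *[OF HS_opp[OF h]] p unfolding opp_opp[OF h] by blast
  qed
qed

text \<open>
  Dig at all halfspaces in turn, starting at \<open>v\<close> and always moving away from \<open>p\<close>. The halfspaces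
  that eventually contain the resulting sequence form an ultrafilter, and digging at \<open>h\<close> puts a
  smaller halfspace below \<open>h\<close> or below its complement, whichever belongs to the ultrafilter.
\<close>

lemma nt_exists:
  assumes K: "K \<subseteq> HS" "K \<noteq> {}" and p: "p \<in> V" "\<And>k. k \<in> K \<Longrightarrow> p \<notin> k" and v: "v \<in> \<Inter>K"
  obtains \<alpha> where "uf \<alpha>" "non_terminating \<alpha>" "K \<subseteq> \<alpha>"
proof -
  have ne: "HS \<noteq> {}" using K by auto
  have vV: "v \<in> V" using v K HS_V by blast
  define hs where "hs = from_nat_into HS"
  have hs: "hs n \<in> HS" for n unfolding hs_def using ne by (rule from_nat_into)
  have "\<exists>f. \<forall>n. (f n \<in> V \<and> (n = 0 \<longrightarrow> f n = v)) \<and>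
    (d p (f (Suc n)) = d p (f n) + d (f n) (f (Suc n)) \<and>
     (\<exists>k\<in>HS. p \<notin> k \<and> f (Suc n) \<in> k \<and> (k \<subset> hs n \<or> k \<subset> V - hs n)))"
  proof (rule dependent_nat_choice)
    show "\<exists>x. x \<in> V \<and> (0 = (0::nat) \<longrightarrow> x = v)" using vV by blast
    fix x n assume "x \<in> V \<and> (n = (0::nat) \<longrightarrow> x = v)"
    then obtain v' k where "v' \<in> V" "d p v' = d p x + d x v'" "k \<in> HS" "p \<notin> k" "v' \<in> k"
        "k \<subset> hs n \<or> k \<subset> V - hs n"
      using dig_at[OF p(1) _ hs[of n], of x] by blast
    then show "\<exists>y. (y \<in> V \<and> (Suc n = 0 \<longrightarrow> y = v)) \<and> d p y = d p x + d x y \<and>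
      (\<exists>k\<in>HS. p \<notin> k \<and> y \<in> k \<and> (k \<subset> hs n \<or> k \<subset> V - hs n))" by auto
  qed
  then obtain f where f: "\<And>n. f n \<in> V" "f 0 = v"
    "\<And>n. d p (f (Suc n)) = d p (f n) + d (f n) (f (Suc n))"
    "\<And>n. \<exists>k\<in>HS. p \<notin> k \<and> f (Suc n) \<in> k \<and> (k \<subset> hs n \<or> k \<subset> V - hs n)" by blast
  \<comment> \<open>the sequence moves away from \<open>p\<close>, so it never leaves a halfspace not containing \<open>p\<close>\<close>
  have stay1: "f (Suc n) \<in> k" if k: "k \<in> HS" "p \<notin> k" "f n \<in> k" for k n
    using HS_between[OF k(1,2) _ p(1) f(1) f(1) f(3)[symmetric], of n] k(3) by blast
  have stay: "f m \<in> k" if k: "k \<in> HS" "p \<notin> k" "f n \<in> k" and "n \<le> m" for k n m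
    using \<open>n \<le> m\<close> by (induction m rule: dec_induct) (use k stay1 in auto)
  define \<alpha> where "\<alpha> = {k \<in> HS. \<exists>M. \<forall>n\<ge>M. f n \<in> k}"
  have in_\<alpha>: "k \<in> \<alpha>" if "k \<in> HS" "p \<notin> k" "f n \<in> k" for k n
    using that stay[OF that] by (auto simp: \<alpha>_def)
  have one: "h \<in> \<alpha> \<or> V - h \<in> \<alpha>" if h: "h \<in> HS" "p \<notin> h" for h
  proof (cases "\<exists>n. f n \<in> h")
    case True then show ?thesis using in_\<alpha>[OF h] by blast
  next
    case False then show ?thesis using f(1) HS_opp[OF h(1)] by (auto simp: \<alpha>_def)
  qed
  have not_both: False if hb: "h \<in> \<alpha>" "V - h \<in> \<alpha>" for h
  proof -
    obtain M M' where "\<forall>n\<ge>M. f n \<in> h" "\<forall>n\<ge>M'. f n \<in> V - h"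
      using hb unfolding \<alpha>_def by blast
    then have "f (max M M') \<in> h" "f (max M M') \<in> V - h" by (meson max.cobounded1 max.cobounded2)+
    then show False by blast
  qed
  have uf: "uf \<alpha>"
    unfolding uf_def
  proof (intro conjI ballI impI)
    show "\<alpha> \<subseteq> HS" by (auto simp: \<alpha>_def)
    fix h assume h: "h \<in> HS"
    have "h \<in> \<alpha> \<or> V - h \<in> \<alpha>"
    proof (cases "p \<in> h")
      case True
      then have "p \<notin> V - h" by simp
      from one[OF HS_opp[OF h] this] show ?thesis unfolding opp_opp[OF h] by blast
    next
      case False then show ?thesis using one[OF h] by blast
    qed
    then show "(h \<in> \<alpha>) \<noteq> (V - h \<in> \<alpha>)" using not_both by blast
  next
    fix h k assume "h \<in> \<alpha>" "k \<in> HS" "h \<subseteq> k"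
    then show "k \<in> \<alpha>" unfolding \<alpha>_def by blast
  qed
  have "non_terminating \<alpha>"
    unfolding non_terminating_def
  proof
    fix h assume h: "h \<in> \<alpha>"
    then have hH: "h \<in> HS" using uf uf_HS by blast
    then obtain n where n: "hs n = h"
      using from_nat_into_surj[OF countable_HS] unfolding hs_def by blast
    obtain k where k: "k \<in> HS" "p \<notin> k" "f (Suc n) \<in> k" "k \<subset> h \<or> k \<subset> V - h" using f(4)[of n] n by blast
    have ka: "k \<in> \<alpha>" by (rule in_\<alpha>[OF k(1-3)])
    have "\<not> k \<subset> V - h"
    proof
      assume "k \<subset> V - h"
      then have "V - h \<in> \<alpha>" using uf_up[OF uf ka HS_opp[OF hH]] by blast
      then show False using not_both h by blast
    qed
    then show "\<exists>k\<in>\<alpha>. k \<subset> h" using k ka by blast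
  qed
  moreover have "K \<subseteq> \<alpha>"
  proof
    fix k assume k: "k \<in> K"
    show "k \<in> \<alpha>" by (rule in_\<alpha>[of k 0]) (use k K p(2) v f(2) in auto)
  qed
  ultimately show thesis using that uf by blast
qed

text \<open>
  The path from \<open>p\<close> to \<open>x\<close> has to enter the members of the chain one after the other through
  different edges.
\<close>

lemma chain_dist:
  assumes c: "\<And>n. c n \<in> HS" "\<And>n. c (Suc n) \<subset> c n" and p: "p \<in> V" "p \<notin> c 0"
  shows "x \<in> c n \<Longrightarrow> n < d p x"
proof (induction n arbitrary: x)
  case 0
  then have "x \<in> V" "x \<noteq> p" using c(1) HS_V p by blast+
  then show ?case using d_0[of p x] p by auto
next
  case (Suc n)
  have xV: "x \<in> V" using Suc.prems c(1) HS_V by blast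
  have "c n \<subseteq> c 0" for n using lift_Suc_antimono_le[of c 0 n] c(2) by blast
  then have pn: "p \<in> V - c (Suc n)" using p by blast
  obtain a b where ab: "adj a b" "a \<in> V - c (Suc n)" "b \<notin> V - c (Suc n)" "d p x = d p a + 1 + d b x"
    using crossing_edge[OF p(1) xV pn] Suc.prems by blast
  have b: "b \<in> c (Suc n)" "b \<in> c n" using ab(3) adj_V[OF ab(1)] c(2) by blast+
  have "a \<in> c n"
  proof (rule ccontr)
    assume "a \<notin> c n"
    then have "W b a = c n" "W b a = c (Suc n)"
      using HS_cross[OF c(1) adj_sym[OF ab(1)]] b ab(2) by blast+
    then show False using c(2)[of n] by simp
  qed
  then have "n < d p a" by (rule Suc.IH)
  then show ?case using ab(4) by simp
qed

lemma transverse_card: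
  assumes "finite K" "K \<subseteq> HS" "\<And>h k. h \<in> K \<Longrightarrow> k \<in> K \<Longrightarrow> h \<noteq> k \<Longrightarrow> transv h k"
  shows "card K \<le> N"
proof (cases "K = {}")
  case False
  obtain v f where v: "v \<in> \<Inter>K" "inj_on f K" "f ` K \<subseteq> {a. adj v a}"
    using transverse_family_at_vertex(2)[OF assms(1,2) False assms(3)] by blast
  have "v \<in> V" using v(1) False assms(2) HS_V by blast
  then show ?thesis
    using valence[of v] card_mono[OF _ v(3)] card_image[OF v(2)] by simp
qed simp

text \<open>
  An ultrafilter with the descending chain condition is that of a vertex. Among its minimal
  members those not containing \<open>p\<close> are pairwise transverse, hence finite in number, and the gate of \<open>p\<close>
  in their intersection lies in every minimal member. The halfspaces bounded by the finitely many
  edges at that vertex then determine the ultrafilter. This is why every limit of boundary points is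
  a boundary point.
\<close>

lemma terminating_isolated:
  assumes uf: "uf \<beta>" and no: "\<not> (\<exists>c :: nat \<Rightarrow> 'v set. \<forall>n. c n \<in> \<beta> \<and> c (Suc n) \<subset> c n)"
  shows "\<exists>H. finite H \<and> H \<subseteq> \<beta> \<and> (\<forall>\<gamma>. uf \<gamma> \<and> H \<subseteq> \<gamma> \<longrightarrow> \<gamma> = \<beta>)"
proof (cases "V = {}")
  case True
  then have "HS = {}" using adj_V unfolding HS_def by blast
  then show ?thesis using uf by (intro exI[of _ "{}"]) (auto simp: uf_def)
next
  case False
  then obtain p where p: "p \<in> V" by auto
  define M where "M = {m \<in> \<beta>. \<not> (\<exists>k\<in>\<beta>. k \<subset> m)}"
  have below: "\<exists>m\<in>M. m \<subseteq> h" if h: "h \<in> \<beta>" for h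
  proof (rule ccontr)
    assume no_min: "\<not> ?thesis"
    have smaller: "\<exists>l. (l \<in> \<beta> \<and> l \<subseteq> h) \<and> l \<subset> k" if k: "k \<in> \<beta> \<and> k \<subseteq> h" for k
    proof -
      have "k \<notin> M" using no_min k by blast
      then obtain l where "l \<in> \<beta>" "l \<subset> k" using k unfolding M_def by blast
      then show ?thesis using k by (intro exI[of _ l]) auto
    qed
    have "\<exists>c. \<forall>n::nat. (c n \<in> \<beta> \<and> c n \<subseteq> h) \<and> c (Suc n) \<subset> c n"
    proof (rule dependent_nat_choice)
      show "\<exists>x. x \<in> \<beta> \<and> x \<subseteq> h" using h by auto
    qed (rule smaller)
    then show False using no by metis
  qed
  have M: "M \<subseteq> \<beta>" "M \<subseteq> HS" using uf uf_HS by (auto simp: M_def)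
  have meet: "m \<inter> m' \<noteq> {}" if "m \<in> M" "m' \<in> M" for m m' using uf_meet[OF uf] M that by blast
  define Mp where "Mp = {m \<in> M. p \<notin> m}"
  have tr: "transv m m'" if mm: "m \<in> Mp" "m' \<in> Mp" "m \<noteq> m'" for m m'
  proof -
    have "\<not> m \<subseteq> m'" "\<not> m' \<subseteq> m" using mm by (auto simp: Mp_def M_def)
    moreover have "m \<subseteq> V" "m' \<subseteq> V" using mm M HS_V by (auto simp: Mp_def)
    ultimately show ?thesis using meet[of m m'] mm p unfolding transv_def Mp_def by blast
  qed
  have small: "card F \<le> N" if F: "finite F" "F \<subseteq> Mp" for F
  proof (rule transverse_card[OF F(1)])
    show "F \<subseteq> HS" using F(2) M(2) unfolding Mp_def by blast
    show "transv h k" if "h \<in> F" "k \<in> F" "h \<noteq> k" for h k using tr F(2) that by blast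
  qed
  have finMp: "finite Mp"
    by (rule ccontr) (use infinite_arbitrarily_large[of Mp "Suc N"] small in fastforce)
  obtain v where v: "v \<in> V" "\<And>m. m \<in> M \<Longrightarrow> v \<in> m"
  proof (cases "Mp = {}")
    case True
    then show thesis using that[of p] p by (auto simp: Mp_def)
  next
    case False
    have MpH: "Mp \<subseteq> HS" using M by (auto simp: Mp_def)
    have nonempty: "A \<inter> \<Inter>Mp \<noteq> {}" if A: "A \<in> M" for A
      by (rule helly[OF finMp]) (use MpH HS_convex meet A M HS_ne in \<open>auto simp: Mp_def\<close>)
    have conv: "convex (\<Inter>Mp)" using MpH HS_convex False by (intro convex_Inter) auto
    have sub: "\<Inter>Mp \<subseteq> V" using False MpH HS_V by blast
    have "\<Inter>Mp \<noteq> {}" using nonempty False by (auto simp: Mp_def)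
    then obtain v where v: "v \<in> \<Inter>Mp" "\<And>y. y \<in> \<Inter>Mp \<Longrightarrow> d p y = d p v + d v y"
      using gate[OF conv _ p] by blast
    have vV: "v \<in> V" using v sub by blast
    have "v \<in> m" if m: "m \<in> M" for m
    proof (rule ccontr)
      assume vm: "v \<notin> m"
      then have "m \<notin> Mp" using v(1) by blast
      then have "p \<notin> V - m" "v \<in> V - m" using m vm vV by (auto simp: Mp_def)
      then have "\<Inter>Mp \<subseteq> V - m" using gate_sep[OF p sub v HS_opp] m M by blast
      then show False using nonempty[OF m] by blast
    qed
    then show thesis using that vV by blast
  qed
  have \<beta>: "h \<in> \<beta> \<longleftrightarrow> v \<in> h" if h: "h \<in> HS" for h
  proof -
    have 1: "v \<in> k" if "k \<in> \<beta>" for k using below[OF that] v(2) by blast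
    show ?thesis using 1[of h] 1[of "V - h"] uf_opp[OF uf h] by blast
  qed
  define H where "H = W v ` {a. adj v a}"
  have "finite H" using valence[OF v(1)] by (simp add: H_def)
  moreover have "H \<subseteq> \<beta>" using \<beta> HS_W W_self(1) by (auto simp: H_def)
  moreover have "\<gamma> = \<beta>" if g: "uf \<gamma>" "H \<subseteq> \<gamma>" for \<gamma>
  proof -
    have sub: "\<beta> \<subseteq> \<gamma>"
    proof
      fix h assume h: "h \<in> \<beta>"
      then have hH: "h \<in> HS" using uf uf_HS by blast
      have vh: "v \<in> h" using \<beta> h hH by blast
      note ho = HS_opp[OF hH]
      obtain a where a: "adj v a" "V - h \<subseteq> W a v"
        using gate_edge[OF HS_convex[OF ho] HS_ne[OF ho] v(1)] vh by blast
      have "W v a \<subseteq> h" using a(2) W_compl[OF adj_sym[OF a(1)]] W_V[of v a] by blast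
      moreover have "W v a \<in> \<gamma>" using g a by (auto simp: H_def)
      ultimately show "h \<in> \<gamma>" using uf_up[OF g(1)] hH by blast
    qed
    have "\<gamma> \<subseteq> \<beta>"
    proof
      fix h assume h: "h \<in> \<gamma>"
      then have hH: "h \<in> HS" using g uf_HS by blast
      show "h \<in> \<beta>" using uf_opp[OF uf hH] uf_opp[OF g(1) hH] sub h by blast
    qed
    then show ?thesis using sub by blast
  qed
  ultimately show ?thesis by blast
qed

end

section \<open>Extremal obstructions\<close>

context straight_graph
begin

text \<open>
  In the topology of ultrafilters: the basic open set given by \<open>H\<close> contains no non-terminating
  ultrafilter.
\<close>

definition no_nt :: "'v set set \<Rightarrow> bool" where
  "no_nt H \<longleftrightarrow> \<not> (\<exists>\<gamma>. uf \<gamma> \<and> non_terminating \<gamma> \<and> H \<subseteq> \<gamma>)"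

definition obstruction :: "'v set set \<Rightarrow> 'v set set \<Rightarrow> bool" where
  "obstruction K I \<longleftrightarrow> finite K \<and> K \<subseteq> HS \<and> K \<noteq> {} \<and> finite I \<and> I \<subseteq> HS \<and>
     (\<forall>k\<in>K. \<forall>k'\<in>K. k \<noteq> k' \<longrightarrow> transv k k') \<and> (\<forall>k\<in>K. \<forall>h\<in>I. transv k h) \<and>
     (\<forall>h\<in>I. \<forall>h'\<in>I. h \<inter> h' \<noteq> {}) \<and> no_nt (K \<union> I)"

lemma obstructionD:
  assumes "obstruction K I"
  shows "finite K" "K \<subseteq> HS" "K \<noteq> {}" "finite I" "I \<subseteq> HS"
    "k \<in> K \<Longrightarrow> k' \<in> K \<Longrightarrow> k \<noteq> k' \<Longrightarrow> transv k k'" "k \<in> K \<Longrightarrow> h \<in> I \<Longrightarrow> transv k h"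
    "h \<in> I \<Longrightarrow> h' \<in> I \<Longrightarrow> h \<inter> h' \<noteq> {}" "no_nt (K \<union> I)"
  using assms by (simp_all add: obstruction_def)

lemma no_nt_dominate:
  assumes "no_nt H" "H \<subseteq> HS" "\<And>h. h \<in> H \<Longrightarrow> \<exists>k\<in>H'. k \<subseteq> h"
  shows "no_nt H'"
  unfolding no_nt_def
proof
  assume "\<exists>\<gamma>. uf \<gamma> \<and> non_terminating \<gamma> \<and> H' \<subseteq> \<gamma>"
  then obtain \<gamma> where g: "uf \<gamma>" "non_terminating \<gamma>" "H' \<subseteq> \<gamma>" by blast
  have "H \<subseteq> \<gamma>"
  proof
    fix h assume h: "h \<in> H"
    then obtain k where "k \<in> H'" "k \<subseteq> h" using assms(3) by blast
    then show "h \<in> \<gamma>" using uf_up[OF g(1)] g(3) assms(2) h by blast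
  qed
  then show False using assms(1) g unfolding no_nt_def by blast
qed

text \<open>
  The members of \<open>H\<close> that contain a member of the chain are implied by it. The others are
  transverse to all late members of the chain, because the chain eventually avoids any given vertex.
\<close>

lemma obstruction_exists:
  assumes a: "uf \<alpha>" and c: "\<And>n. c n \<in> \<alpha>" "\<And>n. c (Suc n) \<subset> c n"
    and H: "finite H" "H \<subseteq> \<alpha>" "no_nt H"
  shows "\<exists>K I. obstruction K I"
proof -
  have cH: "c n \<in> HS" for n using uf_HS[OF a c(1)] .
  obtain p where p: "p \<in> V" "p \<notin> c 0" using HS_ne[OF HS_opp[OF cH[of 0]]] by blast
  have esc: "x \<notin> c n" if "d p x \<le> n" for x n
    using chain_dist[of c p x n] cH c(2) p that by fastforce
  have anti: "c m \<subseteq> c n" if "n \<le> m" for n m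
    using lift_Suc_antimono_le[of c, OF _ that] c(2) by blast
  \<comment> \<open>every other member of \<open>H\<close> contains some member of the chain\<close>
  define I where "I = {h \<in> H. \<forall>n. c n \<inter> (V - h) \<noteq> {}}"
  have HH: "H \<subseteq> HS" using H(2) uf_HS[OF a] by blast
  have "\<exists>M. \<forall>n\<ge>M. (h \<notin> I \<longrightarrow> c n \<subseteq> h) \<and> (h \<in> I \<longrightarrow> transv (c n) h)" if h: "h \<in> H" for h
  proof (cases "h \<in> I")
    case True
    have hH: "h \<in> HS" using h HH by blast
    obtain x y where xy: "x \<in> h" "y \<in> V - h" using HS_ne[OF hH] HS_ne[OF HS_opp[OF hH]] by blast
    have xV: "x \<in> V" using xy hH HS_V by blast
    have "transv (c n) h" if n: "n \<ge> max (d p x) (d p y)" for n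
    proof -
      have "x \<notin> c n" "y \<notin> c n" using esc[of x n] esc[of y n] n by auto
      moreover have "c n \<inter> h \<noteq> {}" using uf_meet[OF a c(1)] h H(2) by blast
      moreover have "c n \<inter> (V - h) \<noteq> {}" using True unfolding I_def by blast
      ultimately show ?thesis using xy xV unfolding transv_def by blast
    qed
    then show ?thesis using True by blast
  next
    case False
    then obtain M where "c M \<inter> (V - h) = {}" using h unfolding I_def by blast
    then have "c M \<subseteq> h" using HS_V[OF cH] by blast
    then have "\<forall>n\<ge>M. c n \<subseteq> h" using anti by blast
    then show ?thesis using False by blast
  qed
  then obtain Mf where Mf: "\<And>h n. h \<in> H \<Longrightarrow> n \<ge> Mf h \<Longrightarrow>
     (h \<notin> I \<longrightarrow> c n \<subseteq> h) \<and> (h \<in> I \<longrightarrow> transv (c n) h)" by metis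
  define M where "M = Max (insert 0 (Mf ` H))"
  have M: "Mf h \<le> M" if "h \<in> H" for h using that H(1) by (simp add: M_def)
  have "obstruction {c M} I"
    unfolding obstruction_def
  proof (intro conjI ballI impI)
    show "finite I" using H(1) by (simp add: I_def)
    show "I \<subseteq> HS" using HH by (auto simp: I_def)
    show "no_nt ({c M} \<union> I)"
    proof (rule no_nt_dominate[OF H(3) HH])
      fix h assume "h \<in> H"
      then show "\<exists>k\<in>{c M} \<union> I. k \<subseteq> h" using Mf[of h M] M by blast
    qed
  next
    fix k h assume "k \<in> {c M}" "h \<in> I"
    then show "transv k h" using Mf[of h M] M by (auto simp: I_def)
  next
    fix h h' assume "h \<in> I" "h' \<in> I"
    then show "h \<inter> h' \<noteq> {}" using uf_meet[OF a] H(2) by (auto simp: I_def)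
  qed (use cH in auto)
  then show ?thesis by blast
qed

lemma obstruction_card: assumes "obstruction K I" shows "card K \<le> N"
  by (rule transverse_card[OF obstructionD(1,2,6)[OF assms]])

text \<open>
  A transverse family \<open>K\<close> alone, together with its complements, satisfies the hypotheses of
  \<open>nt_exists\<close>.
\<close>

lemma obstruction_nonempty: assumes "obstruction K I" shows "I \<noteq> {}"
proof
  assume I: "I = {}"
  note K = obstructionD(1-3)[OF assms]
  obtain p where p: "p \<in> V" "\<And>k. k \<in> K \<Longrightarrow> p \<notin> k"
    using transverse_family_at_vertex(1)[OF K obstructionD(6)[OF assms]] by blast
  obtain v where v: "v \<in> \<Inter>K"
    using transverse_family_at_vertex(2)[OF K obstructionD(6)[OF assms]] by blast
  obtain \<gamma> where "uf \<gamma>" "non_terminating \<gamma>" "K \<subseteq> \<gamma>"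
    by (rule nt_exists[OF K(2,3) p v])
  then show False using obstructionD(9)[OF assms] I unfolding no_nt_def by auto
qed

text \<open>
  Lexicographic: first the size of \<open>I\<close>, then the defect of \<open>K\<close> from its maximal possible size \<open>N\<close>.
\<close>

definition weight :: "'v set set \<Rightarrow> 'v set set \<Rightarrow> nat" where
  "weight K I = card I * Suc N + (N - card K)"

text \<open>
  Here \<open>Y\<close> is the intersection of an obstruction of minimal weight. The set \<open>P\<close> contains the neighbours
  across hyperplanes transverse to all of \<open>K\<close>, and \<open>Q\<close> the other neighbours.
\<close>

theorem join_region:
  assumes a: "uf \<alpha>" and c: "\<And>n :: nat. c n \<in> \<alpha>" "\<And>n. c (Suc n) \<subset> c n"
    and H: "finite H" "H \<subseteq> \<alpha>" "no_nt H"
  obtains Y where "convex Y" "\<And>n. \<exists>u\<in>Y. \<exists>v\<in>Y. n < d u v"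
    "\<And>v. v \<in> Y \<Longrightarrow> \<exists>P Q. P \<noteq> {} \<and> Q \<noteq> {} \<and> P \<inter> Q = {} \<and> P \<union> Q = {a. adj v a} \<and>
       (\<forall>a\<in>P. \<forall>b\<in>Q. W a v \<inter> W b v \<noteq> {})"
proof -
  obtain K0 I0 where "obstruction K0 I0" using obstruction_exists[of \<alpha> c H, OF a c H] by blast
  then obtain K I where ob: "obstruction K I" and
    min: "\<And>K' I'. obstruction K' I' \<Longrightarrow> weight K I \<le> weight K' I'"
    using ex_has_least_nat[of "\<lambda>(K, I). obstruction K I" "(K0, I0)" "\<lambda>(K, I). weight K I"] by auto
  note K = obstructionD(1-3)[OF ob] and I = obstructionD(4,5)[OF ob] and trK = obstructionD(6)[OF ob]
    and trKI = obstructionD(7)[OF ob] and meetI = obstructionD(8)[OF ob] and nt = obstructionD(9)[OF ob]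
  have I_ne: "I \<noteq> {}" by (rule obstruction_nonempty[OF ob])
  define Y where "Y = \<Inter>(K \<union> I)"
  have KI: "K \<union> I \<subseteq> HS" using K I by blast
  have conv: "convex Y" unfolding Y_def using KI K(3) HS_convex by (intro convex_Inter) auto
  have YV: "Y \<subseteq> V" using conv by (simp add: convex_def)
  have Y_ne: "Y \<noteq> {}"
  proof -
    have meet: "B \<inter> C \<noteq> {}" if BC: "B \<in> K \<union> I" "C \<in> K \<union> I" for B C
    proof (cases "B = C")
      case True
      then show ?thesis using HS_ne KI BC by blast
    next
      case False
      have tm: "transv h k \<Longrightarrow> h \<inter> k \<noteq> {}" for h k by (simp add: transv_def)
      show ?thesis
        using BC
      proof (elim UnE)
        show ?thesis if "B \<in> K" "C \<in> K" by (rule tm[OF trK[OF that False]])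
        show ?thesis if "B \<in> K" "C \<in> I" by (rule tm[OF trKI[OF that]])
        show ?thesis if "B \<in> I" "C \<in> K" by (rule tm[OF transv_sym[OF trKI[OF that(2,1)]]])
        show ?thesis if "B \<in> I" "C \<in> I" by (rule meetI[OF that])
      qed
    qed
    obtain k where k: "k \<in> K \<union> I" using K(3) by blast
    have "k \<inter> \<Inter>(K \<union> I) \<noteq> {}"
    proof (rule helly)
      fix B assume B: "B \<in> K \<union> I"
      then show "convex B" using KI HS_convex by blast
      show "k \<inter> B \<noteq> {}" by (rule meet[OF k B])
      fix C assume "C \<in> K \<union> I"
      then show "B \<inter> C \<noteq> {}" by (rule meet[OF B])
    next
      have kH: "k \<in> HS" by (rule subsetD[OF KI k])
      show "convex k" by (rule HS_convex[OF kH])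
      show "k \<noteq> {}" by (rule HS_ne[OF kH])
      show "finite (K \<union> I)" using K(1) I(1) by simp
    qed
    then show ?thesis unfolding Y_def by blast
  qed
  \<comment> \<open>shrinking a member of \<open>K\<close> to \<open>j\<close> while still meeting \<open>Y\<close> allows the members of \<open>I\<close> containing \<open>j\<close>
    to be dropped; by minimality there are none\<close>
  have smaller: "transv j h" if j: "j \<in> HS" "k \<in> K" "j \<subseteq> k" "j \<inter> Y \<noteq> {}" and h: "h \<in> I" for j k h
  proof -
    have kH: "k \<in> HS" using j K by blast
    define K' where "K' = insert j {k' \<in> K. \<not> j \<subseteq> k'}"
    define I' where "I' = {h \<in> I. \<not> j \<subseteq> h}"
    have jmeet: "j \<inter> B \<noteq> {}" if "B \<in> K \<union> I" for B using j(4) that unfolding Y_def by blast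
    have tj: "transv j B" if B: "B \<in> K \<union> I" "\<not> j \<subseteq> B" for B
    proof -
      have "B \<noteq> k" using B j by blast
      then have "transv k B" using B trK trKI j(2) by blast
      then show ?thesis using jmeet[OF B(1)] B(2) j(3) HS_V[OF j(1)] unfolding transv_def by blast
    qed
    have "obstruction K' I'"
      unfolding obstruction_def
    proof (intro conjI ballI impI)
      show "no_nt (K' \<union> I')"
        by (rule no_nt_dominate[OF nt KI]) (auto simp: K'_def I'_def)
    next
      fix k1 k2 assume "k1 \<in> K'" "k2 \<in> K'" "k1 \<noteq> k2"
      then show "transv k1 k2" using tj trK transv_sym unfolding K'_def by blast
    next
      fix k1 h assume "k1 \<in> K'" "h \<in> I'"
      then show "transv k1 h" using tj trKI unfolding K'_def I'_def by blast
    next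
      fix h h' assume "h \<in> I'" "h' \<in> I'"
      then show "h \<inter> h' \<noteq> {}" using meetI unfolding I'_def by blast
    qed (use K I j in \<open>auto simp: K'_def I'_def\<close>)
    then have le: "weight K I \<le> weight K' I'" by (rule min)
    have "I' = I"
    proof (rule ccontr)
      assume "I' \<noteq> I"
      then have "I' \<subset> I" by (auto simp: I'_def)
      then have "card I' < card I" using I(1) by (rule psubset_card_mono[rotated])
      then have "Suc (card I') * Suc N \<le> card I * Suc N" by (intro mult_le_mono1) simp
      then have "weight K' I' < weight K I" unfolding weight_def by simp
      then show False using le by simp
    qed
    then show ?thesis using h tj[of h] unfolding I'_def by blast
  qed
  \<comment> \<open>leaving \<open>Y\<close> across a member \<open>B\<close> would put the complement of \<open>B\<close> inside \<open>k\<close>, against transversality\<close>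
  have inY: "b \<in> Y" if v: "v \<in> Y" and b: "adj v b" and k: "k \<in> K" "W b v \<subseteq> k" for v b k
    unfolding Y_def
  proof
    fix B assume B: "B \<in> K \<union> I"
    show "b \<in> B"
    proof (rule ccontr)
      assume nb: "b \<notin> B"
      have "v \<in> B" using v B unfolding Y_def by blast
      then have "W v b = B" using HS_cross[OF _ b _ nb] KI B by blast
      then have "V - B \<subseteq> k" using W_compl[OF b] k by simp
      then have "\<not> transv k B" "B \<noteq> k" using k HS_ne[OF HS_opp, of k] K unfolding transv_def by blast+
      then show False using trK trKI k B by blast
    qed
  qed
  have unb: "\<exists>u\<in>Y. \<exists>v\<in>Y. n < d u v" for n
  proof -
    obtain k where k: "k \<in> K" using K by blast
    have kH: "V - k \<in> HS" using k K HS_opp by blast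
    obtain p where p: "p \<in> V - k" using HS_ne[OF kH] by blast
    \<comment> \<open>digging deeper into \<open>k\<close> stays in \<open>Y\<close> and moves away from the complement of \<open>k\<close>\<close>
    have far: "\<exists>v\<in>Y. m \<le> d v p" for m
    proof (induction m)
      case (Suc m)
      then obtain v where v: "v \<in> Y" "m \<le> d v p" by blast
      have vk: "v \<in> V" "v \<notin> V - k" using v YV k unfolding Y_def by blast+
      obtain a where a: "adj v a" "V - k \<subseteq> W a v"
        using gate_edge[OF HS_convex[OF kH] HS_ne[OF kH] vk] by blast
      obtain b where b: "adj v b" "W b v \<inter> W a v = {}" using straight[OF a(1)] by blast
      have "W b v \<subseteq> k" using a b W_V[of b v] by blast
      then have "b \<in> Y" by (rule inY[OF v(1) b(1) k])
      moreover have "p \<in> W v b" using p a(2) b(2) W_compl[OF adj_sym[OF b(1)]] by blast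
      then have "d b p = Suc (d v p)" using W_iff[OF b(1)] by simp
      ultimately show ?case using v(2) by (intro bexI[of _ b]) auto
    qed (use Y_ne in blast)
    obtain u where u: "u \<in> Y" using Y_ne by blast
    obtain v where v: "v \<in> Y" "Suc n + d u p \<le> d v p" using far by blast
    have "d v p \<le> d v u + d u p" using d_tri[of v u p] u v YV p by blast
    then have "n < d v u" using v by simp
    then show ?thesis using u v by blast
  qed
  have join: "\<exists>P Q. P \<noteq> {} \<and> Q \<noteq> {} \<and> P \<inter> Q = {} \<and> P \<union> Q = {a. adj v a} \<and>
       (\<forall>a\<in>P. \<forall>b\<in>Q. W a v \<inter> W b v \<noteq> {})" if v: "v \<in> Y" for v
  proof -
    have vV: "v \<in> V" using v YV by blast
    have vB: "v \<in> B" if "B \<in> K \<union> I" for B using v that unfolding Y_def by blast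
    define P where "P = {a. adj v a \<and> (\<forall>k\<in>K. transv (W a v) k)}"
    define Q where "Q = {a. adj v a} - P"
    have Qtr: "transv (W a v) h" if aQ: "a \<in> Q" and h: "h \<in> I" for a h
    proof -
      obtain k where k: "adj v a" "k \<in> K" "\<not> transv (W a v) k" using aQ unfolding P_def Q_def by blast
      have kH: "k \<in> HS" using k K by blast
      note a' = adj_sym[OF k(1)]
      have compl: "V - W a v = W v a" by (rule W_compl[OF a'])
      have vW: "v \<in> V - W a v" using vV W_self(2)[OF a'] by blast
      then have "W a v \<inter> k = {} \<or> W a v \<subseteq> k \<or> V - W a v \<subseteq> k"
        using k(3) vB[of k] k(2) W_V[of a v] unfolding transv_def by blast
      then show ?thesis
      proof (elim disjE)
        assume "W a v \<inter> k = {}"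
        then have "W a v = V - k" using HS_enter[OF kH k(1) vB] k(2) by blast
        then show ?thesis using transv_opp[OF kH trKI[OF k(2) h]] by simp
      next
        assume sub: "W a v \<subseteq> k"
        then have "a \<in> Y" by (rule inY[OF v k(1,2)])
        then have "W a v \<inter> Y \<noteq> {}" using W_self(1)[OF a'] by blast
        then show ?thesis by (rule smaller[OF HS_W[OF a'] k(2) sub _ h])
      next
        assume sub: "V - W a v \<subseteq> k"
        then have "W v a \<subseteq> k" using compl by simp
        moreover have "W v a \<inter> Y \<noteq> {}" using v W_self(1)[OF k(1)] by blast
        ultimately have "transv (W v a) h" by (rule smaller[OF HS_W[OF k(1)] k(2) _ _ h])
        then show ?thesis using transv_opp[OF HS_W[OF k(1)]] W_compl[OF k(1)] by metis
      qed
    qed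
    \<comment> \<open>otherwise \<open>W a v\<close> could be added to \<open>K\<close>, contrary to its maximality\<close>
    have Pout: "\<exists>h\<in>I. V - h \<subseteq> W a v" if aP: "a \<in> P" for a
    proof (rule ccontr)
      assume no: "\<not> ?thesis"
      have av: "adj v a" and tr: "\<And>k. k \<in> K \<Longrightarrow> transv (W a v) k" using aP unfolding P_def by blast+
      note a' = adj_sym[OF av]
      define K' where "K' = insert (W a v) K"
      define I' where "I' = {h \<in> I. \<not> W a v \<subseteq> h}"
      have trI: "transv (W a v) h" if h: "h \<in> I'" for h
      proof -
        have hI: "h \<in> I" "\<not> W a v \<subseteq> h" "h \<in> HS" using h I unfolding I'_def by blast+
        have "\<not> V - h \<subseteq> W a v" using no hI(1) by blast
        moreover have "W a v \<inter> h \<noteq> {}"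
          using HS_enter[OF hI(3) av vB] hI(1) calculation by blast
        moreover have "v \<in> (V - W a v) \<inter> h" using vV W_self(2)[OF a'] vB hI(1) by blast
        ultimately show ?thesis using hI(2) W_V[of a v] unfolding transv_def by blast
      qed
      have ob': "obstruction K' I'"
        unfolding obstruction_def
      proof (intro conjI ballI impI)
        show "no_nt (K' \<union> I')"
          by (rule no_nt_dominate[OF nt KI]) (auto simp: K'_def I'_def)
      next
        fix k1 k2 assume "k1 \<in> K'" "k2 \<in> K'" "k1 \<noteq> k2"
        then show "transv k1 k2" using tr trK transv_sym unfolding K'_def by blast
      next
        fix k1 h assume "k1 \<in> K'" "h \<in> I'"
        then show "transv k1 h" using trI trKI unfolding K'_def I'_def by blast
      next
        fix h h' assume "h \<in> I'" "h' \<in> I'"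
        then show "h \<inter> h' \<noteq> {}" using meetI unfolding I'_def by blast
      qed (use K I HS_W[OF a'] in \<open>auto simp: K'_def I'_def\<close>)
      have "W a v \<notin> K" using tr transv_irrefl by blast
      then have "card K' = Suc (card K)" using K(1) by (simp add: K'_def)
      then have "N - card K' < N - card K" using obstruction_card[OF ob'] by simp
      moreover have "card I' \<le> card I" using I(1) by (intro card_mono) (auto simp: I'_def)
      then have "card I' * Suc N \<le> card I * Suc N" by (rule mult_le_mono1)
      ultimately have "weight K' I' < weight K I" unfolding weight_def by linarith
      then show False using min[OF ob'] by simp
    qed
    have gate: "\<exists>a. adj v a \<and> V - B \<subseteq> W a v" if B: "B \<in> K \<union> I" for B
    proof -
      have BH: "V - B \<in> HS" using B KI HS_opp by blast
      show ?thesis using gate_edge[OF HS_convex[OF BH] HS_ne[OF BH] vV] vB[OF B] by blast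
    qed
    have notr: "\<not> transv (W a v) B" if "V - B \<subseteq> W a v" for a B
      using that unfolding transv_def by blast
    have Q_ne: "Q \<noteq> {}"
    proof -
      obtain k where k: "k \<in> K" using K(3) by blast
      then obtain a where "adj v a" "V - k \<subseteq> W a v" using gate[of k] by blast
      then show ?thesis using notr k unfolding Q_def P_def by blast
    qed
    have P_ne: "P \<noteq> {}"
    proof -
      obtain h where h: "h \<in> I" using I_ne by blast
      then obtain a where a: "adj v a" "V - h \<subseteq> W a v" using gate[of h] by blast
      then have "a \<notin> Q" using notr Qtr h by blast
      then show ?thesis using a unfolding Q_def by blast
    qed
    have meet: "W a v \<inter> W b v \<noteq> {}" if ab: "a \<in> P" "b \<in> Q" for a b
    proof -
      obtain h where h: "h \<in> I" "V - h \<subseteq> W a v" using Pout[OF ab(1)] by blast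
      have "W b v \<inter> (V - h) \<noteq> {}" using Qtr[OF ab(2) h(1)] unfolding transv_def by blast
      then show ?thesis using h(2) by blast
    qed
    have part: "P \<inter> Q = {}" "P \<union> Q = {a. adj v a}" unfolding Q_def P_def by blast+
    show ?thesis
      by (intro exI[of _ P] exI[of _ Q] conjI ballI P_ne Q_ne part) (rule meet)
  qed
  show thesis by (rule that[OF conv unb join])
qed

end

section \<open>From the 1-skeleton back to the complex\<close>

context cat0_cubes
begin

text \<open>
  By the quadrangle condition seen from \<open>a\<close>, the corner opposite to \<open>c\<close> of a square containing
  \<open>b\<close>, \<open>c\<close>, \<open>e\<close> is at distance zero from \<open>a\<close>.
\<close>

lemma four_cycle_sq:
  assumes "adj a b" "adj b c" "adj c e" "adj e a" "a \<noteq> c" "b \<noteq> e"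
  shows "sq a b c e"
proof -
  have a: "a \<in> verts X" using assms adj_verts by blast
  have "d b a = 1" "d e a = 1"
    using dist_bip[of b a a] dist_bip[of e a a] dist_0[OF a a] assms adj_sym a by auto
  moreover have "d c a \<noteq> 0" using dist_0[of c a] assms adj_verts a by metis
  ultimately have "d c a = 2" using dist_bip[OF assms(2) a] by auto
  then obtain z where z: "sq c b z e" "1 = Suc (d z a)"
    using quadrangle_square[OF a adj_sym[OF assms(2)] assms(3,6)] \<open>d b a = 1\<close> \<open>d e a = 1\<close> by auto
  then have "z = a" using dist_0[of z a] a adj_verts by (auto simp: sq_def)
  then show ?thesis using z(1) by (metis sq_flip sq_rot)
qed

sublocale quad_graph "verts X" adj d
proof
  show "\<exists>z. adj w z \<and> adj w' z \<and> d w y = Suc (d z y)"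
    if qs: "y \<in> verts X" "adj x w" "adj x w'" "w \<noteq> w'" "d x y = Suc (d w y)" "d x y = Suc (d w' y)"
    for y x w w'
  proof -
    obtain z where "sq x w z w'" "d w y = Suc (d z y)" by (rule quadrangle_square[OF qs])
    then show ?thesis using adj_sym by (auto simp: sq_def)
  qed
  show "z = x \<or> z = y"
    if "u \<noteq> v" "x \<noteq> y" "adj u x" "adj v x" "adj u y" "adj v y" "adj u z" "adj v z" for u v x y z
  proof (rule ccontr)
    assume ne: "\<not> (z = x \<or> z = y)"
    have "sq u x v y" "sq u x v z" using that ne adj_sym by (auto intro!: four_cycle_sq)
    then show False using sq_unique ne by blast
  qed
  show "\<exists>z. adj x z \<and> d z y = n" if "x \<in> verts X" "y \<in> verts X" "d x y = Suc n" for x y n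
    using dist_step[OF that] by blast
qed (use adj_verts adj_sym dist_0 dist_sym dist_triangle dist_bip in auto)

lemma para_opposite: "para (u, v) (x, y) \<Longrightarrow> opposite_edges X {u, v} {x, y}"
  unfolding para_def using sq_opposite[OF four_cycle_sq[of u v y x]] adj_sym by simp

lemma opposite_para:
  assumes "opposite_edges X {u, v} f"
  shows "\<exists>x y. f = {x, y} \<and> para (u, v) (x, y)"
proof -
  obtain x y where f: "f = {x, y}" and s: "sq u v y x" using opposite_sq[OF assms] by blast
  then have "para (u, v) (x, y)" using sq_distinct[OF s] adj_sym by (auto simp: sq_def para_def)
  then show ?thesis using f by blast
qed

lemma para_iff_opposite_rtranclp:
  "(opposite_edges X)\<^sup>*\<^sup>* {u, v} f \<longleftrightarrow> (\<exists>x y. f = {x, y} \<and> para\<^sup>*\<^sup>* (u, v) (x, y))"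
proof
  show "(opposite_edges X)\<^sup>*\<^sup>* {u, v} f \<Longrightarrow> \<exists>x y. f = {x, y} \<and> para\<^sup>*\<^sup>* (u, v) (x, y)"
  proof (induction rule: rtranclp_induct)
    case (step f g)
    then obtain x y where xy: "f = {x, y}" "para\<^sup>*\<^sup>* (u, v) (x, y)" by blast
    then obtain x' y' where "g = {x', y'}" "para (x, y) (x', y')" using opposite_para step(2) by blast
    then show ?case using rtranclp.rtrancl_into_rtrancl[OF xy(2)] by blast
  qed auto
  have "para\<^sup>*\<^sup>* (u, v) (x, y) \<Longrightarrow> (opposite_edges X)\<^sup>*\<^sup>* {u, v} {x, y}" for x y
  proof (induction rule: rtranclp_induct2)
    case (step a b a' b')
    then show ?case using para_opposite by (meson rtranclp.rtrancl_into_rtrancl)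
  qed simp
  then show "\<exists>x y. f = {x, y} \<and> para\<^sup>*\<^sup>* (u, v) (x, y) \<Longrightarrow> (opposite_edges X)\<^sup>*\<^sup>* {u, v} f" by blast
qed

text \<open>
  The hyperplane dual to \<open>uv\<close> consists of the edges with exactly one end in \<open>W u v\<close>.
\<close>

lemma edge_dual_iff:
  assumes "adj u v" "adj x y"
  shows "{x, y} \<in> dual_hyperplane X {u, v} \<longleftrightarrow> (x \<in> W u v \<longleftrightarrow> y \<notin> W u v)"
proof
  assume "{x, y} \<in> dual_hyperplane X {u, v}"
  then obtain x' y' where xy: "{x, y} = {x', y'}" "para\<^sup>*\<^sup>* (u, v) (x', y')"
    by (auto simp: dual_hyperplane_def para_iff_opposite_rtranclp)
  then have "adj x' y'" using assms(2) by metis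
  then have "x' \<in> W u v" "y' \<notin> W u v" using W_para[OF xy(2)] W_self by blast+
  then show "x \<in> W u v \<longleftrightarrow> y \<notin> W u v" using xy(1) by (auto simp: doubleton_eq_iff)
next
  have *: "{x, y} \<in> dual_hyperplane X {u, v}" if "adj x y" "x \<in> W u v" "y \<notin> W u v" for x y
  proof -
    have "y \<in> W v u" using that adj_verts W_compl[OF assms(1)] by blast
    then have "para\<^sup>*\<^sup>* (u, v) (x, y)" using crossing_para[OF assms(1) that(1,2)] by blast
    then show ?thesis using that(1) para_iff_opposite_rtranclp by (auto simp: dual_hyperplane_def)
  qed
  assume "x \<in> W u v \<longleftrightarrow> y \<notin> W u v"
  then show "{x, y} \<in> dual_hyperplane X {u, v}"
    using *[of x y] *[of y x] assms(2) adj_sym by (auto simp: insert_commute)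
qed

text \<open>
  A convex set is connected, and a geodesic inside \<open>W u v\<close> crosses no edge of the hyperplane.
\<close>

lemma cut_component_W:
  assumes uv: "adj u v" and x: "x \<in> W u v"
  shows "cut_component X (dual_hyperplane X {u, v}) x = W u v"
proof
  let ?r = "\<lambda>a b. {a, b} \<in> edges X - dual_hyperplane X {u, v}"
  have "w \<in> W u v" if "?r\<^sup>*\<^sup>* x w" for w
    using that
  proof (induction rule: rtranclp_induct)
    case (step y z)
    then show ?case using edge_dual_iff[OF uv, of y z] by auto
  qed (rule x)
  then show "cut_component X (dual_hyperplane X {u, v}) x \<subseteq> W u v" by (auto simp: cut_component_def)
  have xV: "x \<in> verts X" using x W_V by blast
  have "?r\<^sup>*\<^sup>* z w" if w: "w \<in> W u v" and "z \<in> W u v" for z w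
    using \<open>z \<in> W u v\<close>
  proof (induction "d z w" arbitrary: z)
    case 0
    then have "z = w" using dist_0 w W_V by (metis subsetD)
    then show ?case by simp
  next
    case (Suc n)
    have V: "z \<in> verts X" "w \<in> verts X" using Suc.prems w W_V by blast+
    obtain y where y: "adj z y" "d y w = n" using dist_step[OF V Suc.hyps(2)[symmetric]] by blast
    have "y \<in> W u v"
      using convexD[OF convex_W[OF uv] Suc.prems w, of y] y adj_verts(2)[OF y(1)] adj_d[OF y(1)] Suc.hyps(2) by simp
    then have "?r\<^sup>*\<^sup>* y w" "?r z y"
      using Suc.hyps(1)[of y] y edge_dual_iff[OF uv y(1)] Suc.prems by auto
    then show ?case by (rule converse_rtranclp_into_rtranclp[rotated])
  qed
  then show "W u v \<subseteq> cut_component X (dual_hyperplane X {u, v}) x"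
    using x by (auto simp: cut_component_def)
qed

lemma edgeE: assumes "e \<in> edges X" obtains u v where "e = {u, v}" "adj u v"
  using assms by (auto simp: edges_def card_2_iff)

lemma edgeE_at: assumes "e \<in> edges X" "v \<in> e" obtains a where "e = {v, a}" "adj v a"
proof -
  obtain x y where xy: "e = {x, y}" "adj x y" using edgeE[OF assms(1)] .
  show thesis
  proof (cases "v = x")
    case True then show ?thesis using that[of y] xy by simp
  next
    case False
    then have "v = y" using assms(2) xy(1) by simp
    then show ?thesis using that[of x] xy adj_sym by (simp add: insert_commute)
  qed
qed

lemma halfspaces_eq: "halfspaces X = HS"
proof
  show "halfspaces X \<subseteq> HS"
  proof
    fix h assume "h \<in> halfspaces X"
    then obtain e w where e: "e \<in> edges X" "w \<in> verts X" "h = cut_component X (dual_hyperplane X e) w"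
      by (auto simp: halfspaces_def hyperplanes_def)
    obtain u v where uv: "e = {u, v}" "adj u v" by (rule edgeE[OF e(1)])
    show "h \<in> HS"
    proof (cases "w \<in> W u v")
      case True
      then have "h = W u v" using e uv cut_component_W[OF uv(2) True] by simp
      then show ?thesis using HS_W[OF uv(2)] by simp
    next
      case False
      then have "w \<in> W v u" using W_compl[OF uv(2)] e(2) by blast
      then have "h = W v u" using e uv cut_component_W[OF adj_sym[OF uv(2)]] by (simp add: insert_commute)
      then show ?thesis using HS_W[OF adj_sym[OF uv(2)]] by simp
    qed
  qed
  show "HS \<subseteq> halfspaces X"
  proof
    fix h assume "h \<in> HS"
    then obtain u v where uv: "adj u v" "h = W u v" by (auto simp: HS_def)
    then have "h = cut_component X (dual_hyperplane X {u, v}) u"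
      using cut_component_W W_self(1) by simp
    then show "h \<in> halfspaces X"
      using uv adj_verts(1)[OF uv(1)] by (auto simp: halfspaces_def hyperplanes_def)
  qed
qed

text \<open>
  If the far sides of two edges at \<open>v\<close> meet, the quadrangle condition yields a square spanned by
  them, in which their hyperplanes intersect.
\<close>

lemma straight_links_W:
  assumes "straight_links X" "adj v a"
  shows "\<exists>b. adj v b \<and> W b v \<inter> W a v = {}"
proof -
  obtain f where f: "f \<in> edges X" "v \<in> f"
    "\<not> hyperplanes_meet X (dual_hyperplane X {v, a}) (dual_hyperplane X f)"
    using assms adj_verts(1)[OF assms(2)] unfolding straight_links_def by blast
  obtain b where b: "f = {v, b}" "adj v b" by (rule edgeE_at[OF f(1,2)])
  have self: "e \<in> dual_hyperplane X e" if "e \<in> edges X" for e using that by (simp add: dual_hyperplane_def)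
  have no: "\<not> ({v, a} \<subseteq> C \<and> {v, b} \<subseteq> C)" if "C \<in> X" for C
    using f(3) self[OF assms(2)] self[OF b(2)] that b(1) unfolding hyperplanes_meet_def by blast
  have "W b v \<inter> W a v = {}"
  proof (rule ccontr)
    assume "\<not> ?thesis"
    then obtain y where y: "y \<in> W b v" "y \<in> W a v" by blast
    have yV: "y \<in> verts X" using y W_V by blast
    have "{v, a} \<in> X" using assms(2) by (simp add: edges_def)
    then have "a \<noteq> b" using no by blast
    moreover have "d v y = Suc (d a y)" "d v y = Suc (d b y)"
      using y W_iff[OF adj_sym[OF b(2)]] W_iff[OF adj_sym[OF assms(2)]] by simp_all
    ultimately obtain z where "sq v a z b"
      using quadrangle_square[OF yV assms(2) b(2)] by blast
    then have "{v, a, z, b} \<in> X" by (simp add: sq_def squares_def)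
    then show False using no by blast
  qed
  then show ?thesis using b by blast
qed

lemma full_subcomplex_convex:
  assumes Y: "convex Y"
  defines "S \<equiv> {C \<in> X. C \<subseteq> Y}"
  shows "verts S = Y" "convex_subcomplex S X"
proof -
  have YV: "Y \<subseteq> verts X" using Y by (simp add: convex_def)
  show vS: "verts S = Y"
  proof
    show "verts S \<subseteq> Y" by (auto simp: verts_def S_def)
    show "Y \<subseteq> verts S"
    proof
      fix y assume "y \<in> Y"
      then have "{y} \<in> S" using vertex_cube YV by (auto simp: S_def)
      then show "y \<in> verts S" by (auto simp: verts_def)
    qed
  qed
  have "subcomplex S X" by (auto simp: subcomplex_def S_def)
  moreover have "edge_path S p" if p: "comb_geodesic X p" "hd p \<in> Y" "last p \<in> Y" for p
  proof -
    have wp: "walk p" and len: "length p = Suc (d (hd p) (last p))"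
      using p(1) by (auto simp: comb_geodesic_def)
    have "set p \<subseteq> Y"
    proof
      fix z assume "z \<in> set p"
      then obtain l r where lr: "p = l @ z # r" by (auto simp: in_set_conv_decomp)
      have zV: "z \<in> verts X" using wp lr by (auto simp: edge_path_def)
      have w: "walk (l @ [z])" "walk (z # r)" using wp lr zV
        by (auto simp: walk_append walk_simps split: if_splits)
      have "d (hd p) z < length (l @ [z])" using dist_le[OF w(1)] lr by (cases l) auto
      moreover have "d z (last p) < length (z # r)" using dist_le[OF w(2)] lr by simp
      moreover have "d (hd p) (last p) \<le> d (hd p) z + d z (last p)"
        using dist_triangle p(2,3) YV zV by blast
      ultimately have "d (hd p) z + d z (last p) = d (hd p) (last p)" using len lr by simp
      then show "z \<in> Y" by (rule convexD[OF Y p(2,3) zV])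
    qed
    moreover have "successively (\<lambda>u v. {u, v} \<in> edges S) p"
    proof -
      have "successively (\<lambda>u v. {u, v} \<in> edges X) p" using wp by (simp add: edge_path_def)
      then show ?thesis
        by (rule successively_mono) (use \<open>set p \<subseteq> Y\<close> in \<open>auto simp: edges_def S_def\<close>)
    qed
    ultimately show ?thesis using wp vS by (simp add: edge_path_def)
  qed
  ultimately show "convex_subcomplex S X" unfolding convex_subcomplex_def vS by blast
qed

text \<open>
  Two edges at \<open>v\<close> span a square as soon as some vertex lies on the far side of both.
\<close>

lemma link_join:
  assumes "P \<noteq> {}" "Q \<noteq> {}" "P \<inter> Q = {}" "P \<union> Q = {a. adj v a}"
    and v: "v \<in> verts X" and meet: "\<And>a b. a \<in> P \<Longrightarrow> b \<in> Q \<Longrightarrow> W a v \<inter> W b v \<noteq> {}"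
  shows "complex_join (vertex_link X v)"
  unfolding complex_join_def graph_join_def
proof (intro exI conjI ballI)
  let ?E = "\<lambda>a. {v, a}"
  have inj: "?E a = ?E b \<longleftrightarrow> a = b" for a b by (auto simp: doubleton_eq_iff)
  show "?E ` P \<noteq> {}" "?E ` Q \<noteq> {}" using assms by auto
  have "inj ?E" by (simp only: inj_def inj) simp
  then show "?E ` P \<inter> ?E ` Q = {}" using assms(3) by (simp add: image_Int[symmetric])
  show "?E ` P \<union> ?E ` Q = \<Union> (vertex_link X v)"
  proof -
    have "?E ` P \<union> ?E ` Q = ?E ` {a. adj v a}" by (simp only: image_Un[symmetric] assms(4))
    also have "\<dots> = {e \<in> edges X. v \<in> e}" by (auto elim: edgeE_at)
    finally show ?thesis by (simp only: link_verts)
  qed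
  fix e f assume "e \<in> ?E ` P" "f \<in> ?E ` Q"
  then obtain a b where ab: "e = {v, a}" "a \<in> P" "f = {v, b}" "b \<in> Q" by blast
  have adj: "adj v a" "adj v b" using assms(4) ab by blast+
  have "a \<noteq> b" using ab assms(3) by blast
  then show "e \<noteq> f" by (simp only: ab inj) simp
  obtain y where y: "y \<in> W a v" "y \<in> W b v" using meet[OF ab(2,4)] by blast
  have yV: "y \<in> verts X" using y W_V by blast
  have "d v y = Suc (d a y)" "d v y = Suc (d b y)"
    using y W_iff[OF adj_sym[OF adj(1)]] W_iff[OF adj_sym[OF adj(2)]] by simp_all
  then obtain z where "sq v a z b"
    using quadrangle_square[OF yV adj \<open>a \<noteq> b\<close>] by blast
  then show "{e, f} \<in> vertex_link X v" unfolding ab by (rule sq_link)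
qed

end

section \<open>Valence, the topology of ultrafilters, and the conclusion\<close>

text \<open>
  Automorphisms preserve the valence, so it takes only the values at the vertices of finitely many
  cubes.
\<close>

lemma valence_bound:
  assumes cx: "cube_complex X" and lf: "locally_finite_complex X" and cc: "cocompact_complex X"
  shows "\<exists>N. \<forall>v\<in>verts X. finite {a. {v, a} \<in> edges X} \<and> card {a. {v, a} \<in> edges X} \<le> N"
proof -
  interpret cubes X by unfold_locales (rule cx)
  have fin: "finite {e \<in> edges X. v \<in> e}" if "v \<in> verts X" for v
    using lf that by (simp add: locally_finite_complex_def)
  obtain K where K: "finite K" "K \<subseteq> X" "\<forall>C\<in>X. \<exists>D\<in>K. \<exists>g. cubical_aut X g \<and> C = g ` D"
    using cc unfolding cocompact_complex_def by (elim exE conjE)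
  define N where "N = Max (insert 0 ((\<lambda>u. card {e \<in> edges X. u \<in> e}) ` \<Union>K))"
  have "finite D" if "D \<in> K" for D using that K(2) card_cube by blast
  then have finK: "finite (\<Union>K)" using K(1) by blast
  have "finite {a. {v, a} \<in> edges X} \<and> card {a. {v, a} \<in> edges X} \<le> N" if v: "v \<in> verts X" for v
  proof -
    obtain D g where D: "D \<in> K" and g: "cubical_aut X g" and vD: "{v} = g ` D"
      using bspec[OF K(3) vertex_cube[OF v]] by (elim bexE exE conjE)
    obtain u where u: "u \<in> D" "g u = v" using vD by blast
    have uV: "u \<in> verts X" using u D K(2) by (auto simp: verts_def)
    have inj: "inj_on g (verts X)" and gX: "(\<lambda>C. g ` C) ` X = X"
      using g by (auto simp: cubical_aut_def bij_betw_def)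
    have "{e \<in> edges X. v \<in> e} \<subseteq> (\<lambda>C. g ` C) ` {e \<in> edges X. u \<in> e}"
    proof
      fix e assume "e \<in> {e \<in> edges X. v \<in> e}"
      then have e: "e \<in> X" "card e = 2" "v \<in> e" by (auto simp: edges_def)
      then obtain C where C: "C \<in> X" "e = g ` C" using gX by blast
      have CV: "C \<subseteq> verts X" using C by (auto simp: verts_def)
      have "card C = 2" using e(2) C card_image[OF inj_on_subset[OF inj CV]] by simp
      moreover obtain w where "w \<in> C" "g w = v" using e(3) C by blast
      then have "u \<in> C" using inj_onD[OF inj, of w u] u uV CV by auto
      ultimately show "e \<in> (\<lambda>C. g ` C) ` {e \<in> edges X. u \<in> e}" using C by (auto simp: edges_def)
    qed
    then have "card {e \<in> edges X. v \<in> e} \<le> card {e \<in> edges X. u \<in> e}"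
      by (rule surj_card_le[OF fin[OF uV]])
    also have "\<dots> \<le> N" using finK u D unfolding N_def by (intro Max_ge) auto
    finally have le: "card {e \<in> edges X. v \<in> e} \<le> N" .
    have img: "(\<lambda>a. {v, a}) ` {a. {v, a} \<in> edges X} \<subseteq> {e \<in> edges X. v \<in> e}" by auto
    have inj2: "inj_on (\<lambda>a. {v, a}) {a. {v, a} \<in> edges X}" by (auto simp: inj_on_def doubleton_eq_iff)
    show ?thesis
      using inj_on_finite[OF inj2 img fin[OF v]] card_inj_on_le[OF inj2 img fin[OF v]] le by simp
  qed
  then show ?thesis by blast
qed

text \<open>
  The generating sets are closed under finite intersections, hence they form a basis.
\<close>

lemma ultrafilter_nbhd:
  assumes "openin (ultrafilter_topology X) T" "\<alpha> \<in> T"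
  shows "\<exists>H. finite H \<and> H \<subseteq> \<alpha> \<and> {\<gamma> \<in> ultrafilters X. H \<subseteq> \<gamma>} \<subseteq> T"
proof -
  let ?B = "{{\<alpha> \<in> ultrafilters X. H \<subseteq> \<alpha>} |H. finite H \<and> H \<subseteq> halfspaces X}"
  have "generate_topology_on ?B T"
    using assms(1) by (simp add: ultrafilter_topology_def openin_topology_generated_by_iff)
  then show ?thesis
    using assms(2)
  proof (induction rule: generate_topology_on.induct)
    case (Int a b)
    then obtain H H' where "finite H" "H \<subseteq> \<alpha>" "{\<gamma> \<in> ultrafilters X. H \<subseteq> \<gamma>} \<subseteq> a"
      "finite H'" "H' \<subseteq> \<alpha>" "{\<gamma> \<in> ultrafilters X. H' \<subseteq> \<gamma>} \<subseteq> b" by blast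
    then show ?case by (intro exI[of _ "H \<union> H'"]) auto
  next
    case (UN K)
    then obtain k where "k \<in> K" "\<alpha> \<in> k" by blast
    then show ?case using UN by (meson Union_upper order_trans)
  next
    case (Basis s)
    then show ?case by auto
  qed simp
qed

lemma openin_ultrafilters:
  assumes "finite H" "H \<subseteq> halfspaces X"
  shows "openin (ultrafilter_topology X) {\<gamma> \<in> ultrafilters X. H \<subseteq> \<gamma>}"
  unfolding ultrafilter_topology_def by (rule topology_generated_by_Basis) (use assms in blast)

lemma topspace_ultrafilters: "topspace (ultrafilter_topology X) = ultrafilters X"
proof
  show "ultrafilters X \<subseteq> topspace (ultrafilter_topology X)"
    using openin_subset[OF openin_ultrafilters[of "{}" X]] by simp
  show "topspace (ultrafilter_topology X) \<subseteq> ultrafilters X"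
    unfolding ultrafilter_topology_def topology_generated_by_topspace by blast
qed

theorem theorem3:
  fixes X :: "'v set set"
  assumes "cat0_cube_complex X"
    and "locally_finite_complex X"
    and "cocompact_complex X"
    and "straight_links X"
    and "roller_boundary X \<noteq> nt_boundary X"
  shows "\<exists>Y. convex_subcomplex Y X \<and> unbounded_subcomplex Y X \<and>
             (\<forall>v\<in>verts Y. complex_join (vertex_link X v))"
proof -
  have cx: "cube_complex X" using assms(1) by (simp add: cat0_cube_complex_def)
  interpret cat0_cubes X
    using assms(1) by unfold_locales (auto simp: cat0_cube_complex_def)
  obtain N where N: "\<forall>v\<in>verts X. finite {a. {v, a} \<in> edges X} \<and> card {a. {v, a} \<in> edges X} \<le> N"
    using valence_bound[OF cx assms(2,3)] by blast
  interpret straight_graph "verts X" "\<lambda>u v. {u, v} \<in> edges X" "comb_dist X" N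
    by unfold_locales (use straight_links_W[OF assms(4)] N in auto)
  have uf_eq: "\<alpha> \<in> ultrafilters X \<longleftrightarrow> uf \<alpha>" for \<alpha>
    by (simp add: ultrafilters_def uf_def halfspaces_eq opp_halfspace_def)
  let ?NT = "{\<alpha> \<in> roller_boundary X. non_terminating \<alpha>}"
  have roller_uf: "\<alpha> \<in> roller_boundary X \<Longrightarrow> uf \<alpha>" for \<alpha>
    using uf_eq by (simp add: roller_boundary_def)
  have "nt_boundary X \<subseteq> roller_boundary X"
  proof
    fix \<beta> assume b: "\<beta> \<in> nt_boundary X"
    have cl: "\<beta> \<in> ultrafilter_topology X closure_of ?NT" using b by (simp add: nt_boundary_def)
    have bU: "\<beta> \<in> ultrafilters X"
      using subsetD[OF closure_of_subset_topspace cl] by (simp only: topspace_ultrafilters)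
    then have ufb: "uf \<beta>" by (simp only: uf_eq)
    show "\<beta> \<in> roller_boundary X"
    proof (rule ccontr)
      assume nb: "\<beta> \<notin> roller_boundary X"
      then have "\<not> (\<exists>c :: nat \<Rightarrow> 'v set. \<forall>n. c n \<in> \<beta> \<and> c (Suc n) \<subset> c n)"
        using bU by (simp add: roller_boundary_def)
      from terminating_isolated[OF ufb this]
      obtain H where H: "finite H" "H \<subseteq> \<beta>" "\<forall>\<gamma>. uf \<gamma> \<and> H \<subseteq> \<gamma> \<longrightarrow> \<gamma> = \<beta>"
        by (elim exE conjE)
      have "H \<subseteq> halfspaces X" unfolding halfspaces_eq using H(2) uf_HS[OF ufb] by blast
      then have "openin (ultrafilter_topology X) {\<gamma> \<in> ultrafilters X. H \<subseteq> \<gamma>}"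
        by (rule openin_ultrafilters[OF H(1)])
      moreover have "\<beta> \<in> {\<gamma> \<in> ultrafilters X. H \<subseteq> \<gamma>}" using H(2) bU by simp
      ultimately obtain \<gamma> where g: "\<gamma> \<in> ?NT" "\<gamma> \<in> {\<gamma> \<in> ultrafilters X. H \<subseteq> \<gamma>}"
        using cl unfolding in_closure_of by meson
      have "uf \<gamma>" "H \<subseteq> \<gamma>" using g(2) uf_eq by auto
      then have "\<gamma> = \<beta>" using H(3) by simp
      then show False using g(1) nb by simp
    qed
  qed
  then obtain \<alpha> where a: "\<alpha> \<in> roller_boundary X" "\<alpha> \<notin> nt_boundary X" using assms(5) by blast
  have ufa: "uf \<alpha>" by (rule roller_uf[OF a(1)])
  obtain c :: "nat \<Rightarrow> 'v set" where chain: "\<forall>n. c n \<in> \<alpha> \<and> c (Suc n) \<subset> c n"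
    using a(1) unfolding roller_boundary_def mem_Collect_eq by (elim conjE exE)
  have c: "\<And>n. c n \<in> \<alpha>" "\<And>n. c (Suc n) \<subset> c n" using chain by auto
  have "\<alpha> \<in> topspace (ultrafilter_topology X)" using ufa by (simp only: uf_eq topspace_ultrafilters)
  then have "\<not> (\<forall>T. \<alpha> \<in> T \<and> openin (ultrafilter_topology X) T \<longrightarrow> (\<exists>\<gamma>. \<gamma> \<in> ?NT \<and> \<gamma> \<in> T))"
    using a(2) unfolding nt_boundary_def in_closure_of by simp
  then obtain T where T: "openin (ultrafilter_topology X) T" "\<alpha> \<in> T" "\<And>\<gamma>. \<gamma> \<in> ?NT \<Longrightarrow> \<gamma> \<notin> T"
    by blast
  obtain H where H: "finite H" "H \<subseteq> \<alpha>" "{\<gamma> \<in> ultrafilters X. H \<subseteq> \<gamma>} \<subseteq> T"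
    using ultrafilter_nbhd[OF T(1,2)] by blast
  \<comment> \<open>nonempty, so that the ultrafilters containing it have a member to start a descending chain from\<close>
  obtain H' where H': "finite H'" "H' \<subseteq> \<alpha>" "H \<subseteq> H'" "H' \<noteq> {}"
    using H(1,2) c(1)[of 0] by (intro that[of "insert (c 0) H"]) auto
  have "no_nt H'"
    unfolding no_nt_def
  proof
    assume "\<exists>\<gamma>. uf \<gamma> \<and> non_terminating \<gamma> \<and> H' \<subseteq> \<gamma>"
    then obtain \<gamma> where g: "uf \<gamma>" "non_terminating \<gamma>" "H' \<subseteq> \<gamma>" by blast
    have "\<exists>c. \<forall>n::nat. c n \<in> \<gamma> \<and> c (Suc n) \<subset> c n"
    proof (rule dependent_nat_choice)
      show "\<exists>x. x \<in> \<gamma>" using g(3) H'(4) by blast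
    qed (use g(2) in \<open>auto simp: non_terminating_def\<close>)
    then have "\<gamma> \<in> ?NT" using g uf_eq by (simp add: roller_boundary_def)
    moreover have "\<gamma> \<in> T" using H(3) H'(3) g uf_eq by blast
    ultimately show False using T(3) by blast
  qed
  then obtain Y where Y: "convex Y" "\<And>n. \<exists>u\<in>Y. \<exists>v\<in>Y. n < comb_dist X u v"
    "\<And>v. v \<in> Y \<Longrightarrow> \<exists>P Q. P \<noteq> {} \<and> Q \<noteq> {} \<and> P \<inter> Q = {} \<and> P \<union> Q = {a. {v, a} \<in> edges X} \<and>
       (\<forall>a\<in>P. \<forall>b\<in>Q. W a v \<inter> W b v \<noteq> {})"
    using join_region[of \<alpha> c H', OF ufa c H'(1,2)] by blast
  let ?S = "{C \<in> X. C \<subseteq> Y}"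
  note S = full_subcomplex_convex[OF Y(1)]
  have "unbounded_subcomplex ?S X"
    using S(2) Y(2) unfolding unbounded_subcomplex_def convex_subcomplex_def S(1) by blast
  moreover have "complex_join (vertex_link X v)" if v: "v \<in> verts ?S" for v
  proof -
    have vY: "v \<in> Y" using v S(1) by simp
    have vV: "v \<in> verts X" using vY Y(1) by (auto simp: convex_def)
    from Y(3)[OF vY] obtain P Q where PQ: "P \<noteq> {}" "Q \<noteq> {}" "P \<inter> Q = {}"
      "P \<union> Q = {a. {v, a} \<in> edges X}" "\<forall>a\<in>P. \<forall>b\<in>Q. W a v \<inter> W b v \<noteq> {}"
      by (elim exE conjE)
    show ?thesis by (rule link_join[OF PQ(1-4) vV]) (simp add: PQ(5))
  qed
  ultimately show ?thesis using S(2) by blast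
qed

end
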